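(* Let two disclinations with Frank angles $s_1,s_2\in\mathbb{R}\setminus\{0\}$ be constrained to remain superposed. The constraint is introduced under the conditions that $s_1+s_2\neq0$ and that the initial superposition point is in $B_1(0)\setminus\{0\}$; the effective Frank angle $s_{\mathrm e}$ below is nevertheless allowed to be zero or different from zero. For a constant vector $\varepsilon\in\mathbb{R}^2$ of arbitrarily small magnitude, consider the constrained system, for $T>0$, $$\dot\Xi_1=-\nabla_{\Xi_1}\hat H(\Xi_1,\Xi_2)+\lambda,\qquad \dot\Xi_2=-\nabla_{\Xi_2}\hat H(\Xi_1,\Xi_2)-\lambda,\qquad \Xi_1-\Xi_2-\varepsilon=0,$$ where $\lambda(T)\in\mathbb{R}^2$ is the Lagrange multiplier of the constraint. By differentiating the constraint in time, it can be rewritten in the decoupled form $$\dot\Xi_1=-\tfrac12\big[\nabla_{\Xi_1}\hat H(\Xi_1,\Xi_1-\varepsilon)+\nabla_{\Xi_2}\hat H(\Xi_1,\Xi_1-\varepsilon)\big],\qquad \dot\Xi_2=\dot\Xi_1,\qquad \lambda=-\nabla_{\Xi_2}\hat H(\Xi_1,\Xi_1-\varepsilon)-\dot\Xi_1 .$$ Let $(\Xi_1(T,\varepsilon),\Xi_2(T,\varepsilon),\lambda(T,\varepsilon))$ be the solution complying with the initial conditions $\Xi_1(0)=\Xi_{\mathrm{e}0}$, $\Xi_2(0)=\Xi_{\mathrm{e}0}-\varepsilon$. Then, in the limit $\varepsilon\to0$, these triples converge to the solution of the problem (with $\Xi_1$ and $\Xi_2$ both tending to $\Xi_{\mathrm e}$)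 $$\dot\Xi_{\mathrm{e}}(T)=2s_{\mathrm{e}}^2(1-|\Xi_{\mathrm{e}}(T)|^2)\,\Xi_{\mathrm{e}}(T),\qquad \lambda(T)=(s_2^2-s_1^2)(1-|\Xi_{\mathrm{e}}(T)|^2)\,\Xi_{\mathrm{e}}(T)\quad(T>0),\qquad \Xi_{\mathrm{e}}(0)=\Xi_{\mathrm{e}0},$$ with $s_{\mathrm{e}}=(s_1+s_2)/\sqrt2$.
   Context: $B_1(0)\subset\mathbb{R}^2$ is the open unit disk. For $\Xi_1\neq\Xi_2$ in $B_1(0)$, the non-dimensional elastic energy of two disclinations located at $\Xi_1,\Xi_2$ with Frank angles $s_1,s_2$ is $$\hat H(\Xi_1,\Xi_2)=\tfrac12s_1^2(1-|\Xi_1|^2)^2+\tfrac12s_2^2(1-|\Xi_2|^2)^2+s_1s_2(1-|\Xi_1|^2)(1-|\Xi_2|^2)+s_1s_2|\Xi_1-\Xi_2|^2\log\Phi_{12},$$ $$\Phi_{12}=\frac{|\Xi_1-\Xi_2|^2}{|\Xi_1-\Xi_2|^2+(1-|\Xi_1|^2)(1-|\Xi_2|^2)}.$$ The vector $\varepsilon$ is introduced so that the logarithm is well defined. In the absence of the constraint the dynamics is $\dot\Xi_k=-\nabla_{\Xi_k}\hat H$. A dot denotes $\mathrm{d}/\mathrm{d}T$. The mode of convergence as $\varepsilon\to0$ is not specified. *)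

theory Defs
  imports "HOL-Analysis.Analysis"
begin

definition Phi12 :: "real^2 \<Rightarrow> real^2 \<Rightarrow> real" where
  "Phi12 x y =
     (norm (x - y))^2 / ((norm (x - y))^2 + (1 - (norm x)^2) * (1 - (norm y)^2))"

text \<open>The energy is meaningful for distinct points of the open unit disk; elsewhere it
  takes whatever value the total functions \<open>/\<close> and \<open>ln\<close> give.\<close>

definition H_hat :: "real \<Rightarrow> real \<Rightarrow> real^2 \<Rightarrow> real^2 \<Rightarrow> real" where
  "H_hat s1 s2 x y =
     1/2 * s1^2 * (1 - (norm x)^2)^2 + 1/2 * s2^2 * (1 - (norm y)^2)^2
     + s1 * s2 * (1 - (norm x)^2) * (1 - (norm y)^2)
     + s1 * s2 * (norm (x - y))^2 * ln (Phi12 x y)"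

definition grad :: "('a::real_inner \<Rightarrow> real) \<Rightarrow> 'a \<Rightarrow> 'a" where
  "grad f x = (THE D. GDERIV f x :> D)"

definition grad1_H :: "real \<Rightarrow> real \<Rightarrow> real^2 \<Rightarrow> real^2 \<Rightarrow> real^2" where
  "grad1_H s1 s2 x y = grad (\<lambda>z. H_hat s1 s2 z y) x"

definition grad2_H :: "real \<Rightarrow> real \<Rightarrow> real^2 \<Rightarrow> real^2 \<Rightarrow> real^2" where
  "grad2_H s1 s2 x y = grad (\<lambda>z. H_hat s1 s2 x z) y"

text \<open>For fixed \<open>eps \<noteq> 0\<close> a solution may leave the disk in finite time, so solutions live on
  a time interval \<open>[0, \<tau>)\<close> with \<open>0 < \<tau> \<le> \<infinity>\<close>. The equations hold for positive times, and
  the initial values are attained continuously. The multiplier is only meaningful on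
  \<open>(0, \<tau>)\<close>.\<close>

definition admissible_path ::
  "real^2 \<Rightarrow> real^2 \<Rightarrow> ereal \<Rightarrow> (real \<Rightarrow> real^2) \<Rightarrow> (real \<Rightarrow> real^2) \<Rightarrow> bool" where
  "admissible_path eps xi0 \<tau> X1 X2 \<longleftrightarrow>
     0 < \<tau> \<and>
     continuous_on {T. 0 \<le> T \<and> ereal T < \<tau>} X1 \<and>
     continuous_on {T. 0 \<le> T \<and> ereal T < \<tau>} X2 \<and>
     X1 0 = xi0 \<and> X2 0 = xi0 - eps \<and>
     (\<forall>T. 0 \<le> T \<and> ereal T < \<tau> \<longrightarrow> X1 T \<in> ball 0 1 \<and> X2 T \<in> ball 0 1)"

definition constrained_solution ::
  "real \<Rightarrow> real \<Rightarrow> real^2 \<Rightarrow> real^2 \<Rightarrow> ereal \<Rightarrow>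
   (real \<Rightarrow> real^2) \<Rightarrow> (real \<Rightarrow> real^2) \<Rightarrow> (real \<Rightarrow> real^2) \<Rightarrow> bool" where
  "constrained_solution s1 s2 eps xi0 \<tau> X1 X2 lam \<longleftrightarrow>
     admissible_path eps xi0 \<tau> X1 X2 \<and>
     (\<forall>T. 0 < T \<and> ereal T < \<tau> \<longrightarrow>
        (X1 has_vector_derivative (- grad1_H s1 s2 (X1 T) (X2 T) + lam T)) (at T) \<and>
        (X2 has_vector_derivative (- grad2_H s1 s2 (X1 T) (X2 T) - lam T)) (at T) \<and>
        X1 T - X2 T - eps = 0)"

definition decoupled_velocity :: "real \<Rightarrow> real \<Rightarrow> real^2 \<Rightarrow> real^2 \<Rightarrow> real^2" where
  "decoupled_velocity s1 s2 eps x =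
     - ((1/2) *\<^sub>R (grad1_H s1 s2 x (x - eps) + grad2_H s1 s2 x (x - eps)))"

definition decoupled_solution ::
  "real \<Rightarrow> real \<Rightarrow> real^2 \<Rightarrow> real^2 \<Rightarrow> ereal \<Rightarrow>
   (real \<Rightarrow> real^2) \<Rightarrow> (real \<Rightarrow> real^2) \<Rightarrow> (real \<Rightarrow> real^2) \<Rightarrow> bool" where
  "decoupled_solution s1 s2 eps xi0 \<tau> X1 X2 lam \<longleftrightarrow>
     admissible_path eps xi0 \<tau> X1 X2 \<and>
     (\<forall>T. 0 < T \<and> ereal T < \<tau> \<longrightarrow>
        (X1 has_vector_derivative decoupled_velocity s1 s2 eps (X1 T)) (at T) \<and>
        (X2 has_vector_derivative decoupled_velocity s1 s2 eps (X1 T)) (at T) \<and>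
        lam T = - grad2_H s1 s2 (X1 T) (X1 T - eps) - decoupled_velocity s1 s2 eps (X1 T))"

definition maximal_constrained_solution ::
  "real \<Rightarrow> real \<Rightarrow> real^2 \<Rightarrow> real^2 \<Rightarrow> ereal \<Rightarrow>
   (real \<Rightarrow> real^2) \<Rightarrow> (real \<Rightarrow> real^2) \<Rightarrow> (real \<Rightarrow> real^2) \<Rightarrow> bool" where
  "maximal_constrained_solution s1 s2 eps xi0 \<tau> X1 X2 lam \<longleftrightarrow>
     constrained_solution s1 s2 eps xi0 \<tau> X1 X2 lam \<and>
     (\<forall>\<tau>' Y1 Y2 mu. constrained_solution s1 s2 eps xi0 \<tau>' Y1 Y2 mu \<longrightarrow> \<tau>' \<le> \<tau>)"

definition eff_angle :: "real \<Rightarrow> real \<Rightarrow> real" where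
  "eff_angle s1 s2 = (s1 + s2) / sqrt 2"

definition limit_solution ::
  "real \<Rightarrow> real \<Rightarrow> real^2 \<Rightarrow> (real \<Rightarrow> real^2) \<Rightarrow> (real \<Rightarrow> real^2) \<Rightarrow> bool" where
  "limit_solution s1 s2 xi0 X lam \<longleftrightarrow>
     continuous_on {0..} X \<and> X 0 = xi0 \<and>
     (\<forall>T>0.
        (X has_vector_derivative
           (2 * (eff_angle s1 s2)^2 * (1 - (norm (X T))^2)) *\<^sub>R X T) (at T) \<and>
        lam T = ((s2^2 - s1^2) * (1 - (norm (X T))^2)) *\<^sub>R X T)"

end

theory Submission
  imports Defs "HOL-Real_Asymp.Real_Asymp"
begin

text \<open>After elimination of the multiplier, the energy gradients combine so that the logarithm cancels in
  the velocity \<open>drift s1 s2 eps\<close>, while in the multiplier it only occurs as \<open>ln |eps|\<^sup>2\<close> times \<open>eps\<close>,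
  which tends to 0. Both therefore extend continuously to \<open>eps = 0\<close>, uniformly on compact subsets of
  the disk, and their values there are the right-hand sides of the limit problem. The limit
  trajectory stays in a compact subset of the disk up to any time, so a comparison estimate keeps the
  constrained trajectories near it for small \<open>eps\<close>; as they exist slightly longer than required,
  maximality controls the lifetimes.\<close>

text \<open>Once the logarithm is under control, the delicate quantity is the denominator of
  \<open>Phi12\<close>. It is positive for distinct points of the closed disk and for arbitrary
  points of the open disk, but vanishes at coincident points of the unit circle. Hence regularity up
  to the boundary is available for each fixed \<open>eps \<noteq> 0\<close>, which serves existence
  and uniqueness, whereas regularity uniform in \<open>eps\<close> requires a positive distance from
  the circle. The limit problem provides that distance on bounded time intervals: the factor
  \<open>1 - |X|^2\<close> makes the circle consist of equilibria, which are not reached in finite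
  time.\<close>

section \<open>Ordinary differential equations with Lipschitz right-hand side\<close>

text \<open>Working with the squared distance \<open>u\<close> avoids integrals: \<open>u' \<le> 2 L u + 2 \<delta> \<surd>u \<le> (2 L + 1) u + \<delta>\<^sup>2\<close>.\<close>

lemma ode_comparison:
  fixes x y p q :: "real \<Rightarrow> 'a::real_inner"
  assumes "0 \<le> T" "0 \<le> L" "0 \<le> \<delta>"
    and cont: "continuous_on {0..T} x" "continuous_on {0..T} y" and init: "x 0 = y 0"
    and x': "\<And>t. 0 < t \<Longrightarrow> t < T \<Longrightarrow> (x has_vector_derivative p t) (at t)"
    and y': "\<And>t. 0 < t \<Longrightarrow> t < T \<Longrightarrow> (y has_vector_derivative q t) (at t)"
    and pq: "\<And>t. 0 < t \<Longrightarrow> t < T \<Longrightarrow> norm (p t - q t) \<le> L * norm (x t - y t) + \<delta>"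
  shows "(norm (x T - y T))\<^sup>2 \<le> \<delta>\<^sup>2 * T * exp ((2 * L + 1) * T)"
proof -
  define K where "K = 2 * L + 1"
  \<comment> \<open>With the integrating factor \<open>exp (- K * t)\<close> the differential
    inequality for the squared distance says that \<open>g\<close> is nonincreasing; comparing its
    values at \<open>0\<close> and \<open>T\<close> gives the claim.\<close>
  define g where "g = (\<lambda>t. ((x t - y t) \<bullet> (x t - y t)) * exp (- K * t) - \<delta>\<^sup>2 * t)"
  have "g T \<le> g 0"
  proof (rule DERIV_nonpos_imp_decreasing_open[OF \<open>0 \<le> T\<close>])
    show "continuous_on {0..T} g"
      unfolding g_def by (intro continuous_intros cont)
    fix t :: real assume t: "0 < t" "t < T"
    define e where "e = x t - y t"
    let ?D = "(2 * (e \<bullet> (p t - q t)) - K * (e \<bullet> e)) * exp (- K * t) - \<delta>\<^sup>2"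
    have "DERIV g t :> ?D"
      unfolding g_def has_field_derivative_def
      apply (rule derivative_eq_intros x'[OF t, unfolded has_vector_derivative_def]
          y'[OF t, unfolded has_vector_derivative_def] refl)+
      apply (simp add: fun_eq_iff e_def inner_commute algebra_simps)
      done
    moreover have "?D \<le> 0"
    proof -
      have "e \<bullet> (p t - q t) \<le> norm e * norm (p t - q t)"
        by (rule norm_cauchy_schwarz)
      also have "\<dots> \<le> norm e * (L * norm e + \<delta>)"
        using pq[OF t] by (intro mult_left_mono) (auto simp: e_def)
      finally have "2 * (e \<bullet> (p t - q t)) \<le> 2 * L * (norm e)\<^sup>2 + 2 * norm e * \<delta>"
        by (simp add: algebra_simps power2_eq_square)
      moreover have "2 * norm e * \<delta> \<le> (norm e)\<^sup>2 + \<delta>\<^sup>2"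
        by (rule sum_squares_bound)
      ultimately have *: "2 * (e \<bullet> (p t - q t)) - K * (e \<bullet> e) \<le> \<delta>\<^sup>2"
        by (simp add: K_def power2_norm_eq_inner[symmetric] algebra_simps)
      have "(2 * (e \<bullet> (p t - q t)) - K * (e \<bullet> e)) * exp (- K * t) \<le> \<delta>\<^sup>2 * exp (- K * t)"
        using * by (rule mult_right_mono) simp
      also have "\<dots> \<le> \<delta>\<^sup>2 * 1"
        using t \<open>0 \<le> L\<close> by (intro mult_left_mono) (auto simp: K_def mult_le_0_iff)
      finally show ?thesis by simp
    qed
    ultimately show "\<exists>d. DERIV g t :> d \<and> d \<le> 0" by blast
  qed
  then have "(norm (x T - y T))\<^sup>2 * exp (- K * T) \<le> \<delta>\<^sup>2 * T"
    by (simp add: g_def init power2_norm_eq_inner)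
  then show ?thesis
    unfolding K_def[symmetric] by (simp add: exp_minus field_simps)
qed

text \<open>The comparison estimate with \<open>\<delta> = 0\<close>. A Lipschitz bound on a set
  containing both trajectories suffices, which suits fields that are regular on a part of the
  plane.\<close>

lemma ode_unique:
  fixes x y :: "real \<Rightarrow> 'a::real_inner"
  assumes "0 \<le> T" and lip: "L-lipschitz_on S f"
    and "continuous_on {0..T} x" "continuous_on {0..T} y" "x 0 = y 0"
    and "\<And>t. 0 < t \<Longrightarrow> t < T \<Longrightarrow> (x has_vector_derivative f (x t)) (at t)"
    and "\<And>t. 0 < t \<Longrightarrow> t < T \<Longrightarrow> (y has_vector_derivative f (y t)) (at t)"
    and S: "\<And>t. 0 < t \<Longrightarrow> t < T \<Longrightarrow> x t \<in> S" "\<And>t. 0 < t \<Longrightarrow> t < T \<Longrightarrow> y t \<in> S"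
  shows "x T = y T"
proof -
  have "(norm (x T - y T))\<^sup>2 \<le> 0\<^sup>2 * T * exp ((2 * L + 1) * T)"
    by (rule ode_comparison[where p = "\<lambda>t. f (x t)" and q = "\<lambda>t. f (y t)"])
      (use assms lipschitz_on_normD[OF lip] lipschitz_on_nonneg[OF lip] in auto)
  then show ?thesis by simp
qed

text \<open>The weight compensates the growth of the integral of \<open>exp (K * s)\<close>, so the
  bound is independent of \<open>t\<close>. This yields both boundedness and contraction of the
  weighted integral operator on the whole half line.\<close>

lemma norm_integral_exp_bound:
  fixes g :: "real \<Rightarrow> 'a::euclidean_space"
  assumes "0 < K" "0 \<le> t" "continuous_on {0..t} g"
    and g: "\<And>s. 0 \<le> s \<Longrightarrow> s \<le> t \<Longrightarrow> norm (g s) \<le> C * exp (K * s)"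
  shows "exp (- K * t) * norm (integral {0..t} g) \<le> C / K"
proof -
  have "((\<lambda>s. C * exp (K * s)) has_integral (C * exp (K * t) / K - C * exp (K * 0) / K)) {0..t}"
    by (rule fundamental_theorem_of_calculus)
      (use assms in \<open>auto intro!: derivative_eq_intros simp: has_real_derivative_iff_has_vector_derivative[symmetric]\<close>)
  then have I: "((\<lambda>s. C * exp (K * s)) has_integral (C * exp (K * t) / K - C / K)) {0..t}"
    by simp
  have "0 \<le> norm (g 0)" by simp
  also have "\<dots> \<le> C" using g[of 0] assms by simp
  finally have "0 \<le> C" .
  have "norm (integral {0..t} g) \<le> integral {0..t} (\<lambda>s. C * exp (K * s))"
    using assms I by (intro integral_norm_bound_integral)
      (auto intro: integrable_continuous_real continuous_intros)
  also have "\<dots> \<le> C * exp (K * t) / K"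
    using \<open>0 \<le> C\<close> \<open>0 < K\<close> by (simp add: integral_unique[OF I] del: integral_mult_right)
  finally have "exp (- K * t) * norm (integral {0..t} g) \<le> exp (- K * t) * (C * exp (K * t) / K)"
    by (rule mult_left_mono) simp
  then show ?thesis by (simp add: exp_minus field_simps)
qed

text \<open>Picard iteration on the whole half line at once: in the variable \<open>u t = exp (- K * t) * x t\<close> with
  \<open>K\<close> twice the Lipschitz constant, the integral operator contracts the supremum norm.\<close>

lemma ode_global_existence:
  fixes f :: "'a::euclidean_space \<Rightarrow> 'a"
  assumes lip: "L-lipschitz_on UNIV f"
  obtains x where "x 0 = x0" "continuous_on {0..} x"
    "\<And>t. 0 < t \<Longrightarrow> (x has_vector_derivative f (x t)) (at t)"
proof -
  \<comment> \<open>Adding 1 keeps \<open>K\<close>, which occurs as a divisor, positive when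
    \<open>L = 0\<close>.\<close>
  define M where "M = L + 1"
  define K where "K = 2 * M"
  have "0 \<le> L" using lip by (rule lipschitz_on_nonneg)
  then have M: "0 < M" and K: "0 < K" by (auto simp: M_def K_def)
  have fL: "norm (f a - f b) \<le> M * norm (a - b)" for a b
    using lipschitz_on_normD[OF lip, of a b] mult_right_mono[of L M "norm (a - b)"]
    by (auto simp: M_def)
  have contf: "continuous_on UNIV f"
    using lip by (rule lipschitz_on_continuous_on)
  define h where "h = (\<lambda>u s. f (exp (K * s) *\<^sub>R u s))"
  \<comment> \<open>\<open>max 0 t\<close> extends the operator to negative times by its value at 0,
    so that it acts on the complete type of bounded continuous functions on the real line.\<close>
  define F where "F = (\<lambda>(u :: real \<Rightarrow> 'a) t. exp (- K * max 0 t) *\<^sub>R (x0 + integral {0..max 0 t} (h u)))"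
  have hcont: "continuous_on A (h u)" if "continuous_on UNIV u" for A u
    unfolding h_def
    by (intro continuous_on_compose2[OF contf] continuous_intros continuous_on_subset[OF that]) auto
  have max0: "continuous_on A (max (0::real))" for A
    using continuous_on_max[OF continuous_on_const continuous_on_id, of A "0::real"] by simp
  have intcont: "continuous_on UNIV (\<lambda>t. integral {0..max 0 t} (h u))" if "continuous_on UNIV u" for u
  proof -
    have "isCont (\<lambda>t. integral {0..max 0 t} (h u)) t" for t
    proof -
      define b where "b = max 0 t + 1"
      have "continuous_on {0..b} (\<lambda>t. integral {0..t} (h u))"
        by (rule indefinite_integral_continuous_1) (intro integrable_continuous_real hcont that)
      then have "continuous_on {..b} (\<lambda>t. integral {0..max 0 t} (h u))"
        by (rule continuous_on_compose2[OF _ max0]) (auto simp: b_def)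
      then have "continuous_on {..<b} (\<lambda>t. integral {0..max 0 t} (h u))"
        by (rule continuous_on_subset) auto
      moreover have "t \<in> {..<b}" by (auto simp: b_def)
      ultimately show ?thesis
        by (metis continuous_on_eq_continuous_at open_lessThan)
    qed
    then show ?thesis by (simp add: continuous_at_imp_continuous_on)
  qed
  have Fcont: "continuous_on UNIV (F u)" if "continuous_on UNIV u" for u
    unfolding F_def by (intro continuous_intros intcont that max0)
  have Fb: "F u \<in> bcontfun" if u: "u \<in> bcontfun" for u
  proof -
    have uc: "continuous_on UNIV u" and "bounded (range u)"
      using u by (auto simp: bcontfun_def)
    then obtain B where B: "norm (u s) \<le> B" for s by (auto simp: bounded_iff)
    have "norm (h u s) \<le> (norm (f 0) + M * B) * exp (K * s)" if "0 \<le> s" for s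
    proof -
      have "norm (h u s) \<le> norm (f 0) + norm (h u s - f 0)"
        by (metis add.commute diff_add_cancel norm_triangle_ineq)
      also have "norm (h u s - f 0) \<le> M * (exp (K * s) * norm (u s))"
        using fL[of "exp (K * s) *\<^sub>R u s" 0] by (simp add: h_def)
      also have "\<dots> \<le> M * (exp (K * s) * B)"
        using B M by (intro mult_left_mono) auto
      also have "norm (f 0) \<le> norm (f 0) * exp (K * s)"
        using that K by (simp add: mult_le_cancel_left1)
      finally show ?thesis by (simp add: algebra_simps)
    qed
    then have *: "exp (- K * t) * norm (integral {0..t} (h u)) \<le> (norm (f 0) + M * B) / K" if "0 \<le> t" for t
      using that K by (intro norm_integral_exp_bound hcont uc) auto
    have "norm (F u t) \<le> norm x0 + (norm (f 0) + M * B) / K" for t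
    proof -
      let ?t = "max 0 t"
      have "norm (F u t) \<le> exp (- K * ?t) * norm x0 + exp (- K * ?t) * norm (integral {0..?t} (h u))"
        unfolding F_def scaleR_add_right by (rule norm_triangle_le) simp
      also have "exp (- K * ?t) * norm x0 \<le> 1 * norm x0"
        using K by (intro mult_right_mono) auto
      finally show ?thesis using *[of ?t] by simp
    qed
    then show ?thesis
      using Fcont[OF uc] by (auto simp: bcontfun_def bounded_iff)
  qed
  have contr: "dist (F u t) (F w t) \<le> 1 / 2 * B"
    if uw: "continuous_on UNIV u" "continuous_on UNIV w" "\<And>s. dist (u s) (w s) \<le> B" for u w t B
  proof -
    let ?t = "max 0 t"
    have "norm (h u s - h w s) \<le> (M * B) * exp (K * s)" for s
    proof -
      have "norm (h u s - h w s) \<le> M * norm (exp (K * s) *\<^sub>R u s - exp (K * s) *\<^sub>R w s)"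
        unfolding h_def by (rule fL)
      also have "\<dots> = M * (exp (K * s) * dist (u s) (w s))"
        by (simp add: dist_norm flip: scaleR_diff_right)
      also have "\<dots> \<le> M * (exp (K * s) * B)"
        using uw(3) M by (intro mult_left_mono) auto
      finally show ?thesis by (simp add: algebra_simps)
    qed
    then have "exp (- K * ?t) * norm (integral {0..?t} (\<lambda>s. h u s - h w s)) \<le> (M * B) / K"
      using K by (intro norm_integral_exp_bound continuous_intros hcont uw) auto
    moreover have "integral {0..?t} (\<lambda>s. h u s - h w s) = integral {0..?t} (h u) - integral {0..?t} (h w)"
      by (intro Henstock_Kurzweil_Integration.integral_diff integrable_continuous_real hcont uw)
    moreover have "dist (F u t) (F w t)
        = exp (- K * ?t) * norm (integral {0..?t} (h u) - integral {0..?t} (h w))"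
      unfolding F_def dist_norm by (simp flip: scaleR_diff_right)
    ultimately show ?thesis using M by (simp add: K_def)
  qed
  define \<Phi> where "\<Phi> = (\<lambda>u :: real \<Rightarrow>\<^sub>C 'a. Bcontfun (F u))"
  have \<Phi>: "apply_bcontfun (\<Phi> u) = F u" for u
    unfolding \<Phi>_def by (intro Bcontfun_inverse Fb apply_bcontfun)
  have "\<exists>!u. \<Phi> u = u"
  proof (rule banach_fix_type[where c = "1/2"])
    show "\<forall>u w. dist (\<Phi> u) (\<Phi> w) \<le> 1 / 2 * dist u w"
      by (intro allI dist_bound) (simp only: \<Phi>, intro contr dist_bounded continuous_on_apply_bcontfun)
  qed auto
  then obtain u where "\<Phi> u = u" by blast
  then have u: "F u t = u t" for t using \<Phi>[of u] by simp
  define x where "x = (\<lambda>t. exp (K * t) *\<^sub>R u t)"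
  have hu: "h u = (\<lambda>s. f (x s))" by (simp add: h_def x_def)
  have x: "x t = x0 + integral {0..t} (\<lambda>s. f (x s))" if "0 \<le> t" for t
  proof -
    have "x t = exp (K * t) *\<^sub>R F u t" by (simp add: x_def u)
    also have "\<dots> = x0 + integral {0..t} (h u)"
      using that by (simp add: F_def flip: exp_add)
    finally show ?thesis by (simp add: hu)
  qed
  have xc: "continuous_on A x" for A
    unfolding x_def by (intro continuous_intros) auto
  show thesis
  proof
    show "x 0 = x0" using x[of 0] by simp
    show "continuous_on {0..} x" by (rule xc)
    fix t :: real assume t: "0 < t"
    have "((\<lambda>t. integral {0..t} (\<lambda>s. f (x s))) has_vector_derivative f (x t)) (at t within {0..t+1})"
      using t by (intro integral_has_vector_derivative continuous_on_compose2[OF contf xc]) auto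
    then have "((\<lambda>t. x0 + integral {0..t} (\<lambda>s. f (x s))) has_vector_derivative 0 + f (x t)) (at t within {0..t+1})"
      by (intro has_vector_derivative_add has_vector_derivative_const)
    then have "((\<lambda>t. x0 + integral {0..t} (\<lambda>s. f (x s))) has_vector_derivative f (x t)) (at t)"
      using t by (simp add: at_within_Icc_at)
    then show "(x has_vector_derivative f (x t)) (at t)"
      by (rule has_vector_derivative_transform_within_open[where S = "{0<..}"]) (use t x in auto)
  qed
qed

section \<open>Lipschitz functions on compact sets\<close>

text \<open>Compactness bounds both factors. Hiding the constant in an existential quantifier makes
  the rule compositional: an explicit formula is treated by recursion on its syntax, with no
  constants to track.\<close>

lemma lipschitz_scaleR:
  fixes f :: "'a::metric_space \<Rightarrow> real" and g :: "'a \<Rightarrow> 'b::real_normed_vector"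
  assumes "compact S" and "\<exists>L. L-lipschitz_on S f" and "\<exists>L. L-lipschitz_on S g"
  shows "\<exists>L. L-lipschitz_on S (\<lambda>x. f x *\<^sub>R g x)"
proof -
  obtain L M where L: "L-lipschitz_on S f" and M: "M-lipschitz_on S g"
    using assms by blast
  have "bounded (f ` S)" "bounded (g ` S)"
    using assms(1) L M
    by (auto intro!: compact_imp_bounded compact_continuous_image lipschitz_on_continuous_on)
  then obtain A B where A: "\<And>x. x \<in> S \<Longrightarrow> norm (f x) \<le> A" "0 < A"
    and B: "\<And>x. x \<in> S \<Longrightarrow> norm (g x) \<le> B" "0 < B"
    by (auto simp: bounded_pos)
  have "(A * M + B * L)-lipschitz_on S (\<lambda>x. f x *\<^sub>R g x)"
  proof (rule lipschitz_onI)
    fix x y assume xy: "x \<in> S" "y \<in> S"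
    have "f x *\<^sub>R g x - f y *\<^sub>R g y = f x *\<^sub>R (g x - g y) + (f x - f y) *\<^sub>R g y"
      by (simp add: algebra_simps)
    then have "dist (f x *\<^sub>R g x) (f y *\<^sub>R g y) \<le> norm (f x) * dist (g x) (g y) + dist (f x) (f y) * norm (g y)"
      unfolding dist_norm by (metis norm_scaleR norm_triangle_ineq real_norm_def)
    also have "\<dots> \<le> A * (M * dist x y) + (L * dist x y) * B"
      using A B xy lipschitz_onD[OF L xy] lipschitz_onD[OF M xy]
      by (intro add_mono mult_mono) (auto intro: order_trans[OF zero_le_dist])
    finally show "dist (f x *\<^sub>R g x) (f y *\<^sub>R g y) \<le> (A * M + B * L) * dist x y"
      by (simp add: algebra_simps)
  next
    show "0 \<le> A * M + B * L"
      using A B lipschitz_on_nonneg[OF L] lipschitz_on_nonneg[OF M] by simp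
  qed
  then show ?thesis by blast
qed

text \<open>A continuous function without zeros on a compact set has a bounded reciprocal;
  \<open>1/a - 1/b = (b - a)/(a b)\<close> then uses this bound twice.\<close>

lemma lipschitz_inverse:
  fixes f :: "'a::metric_space \<Rightarrow> real"
  assumes "compact S" and "\<exists>L. L-lipschitz_on S f" and nz: "\<And>x. x \<in> S \<Longrightarrow> f x \<noteq> 0"
  shows "\<exists>L. L-lipschitz_on S (\<lambda>x. inverse (f x))"
proof -
  obtain L where L: "L-lipschitz_on S f" using assms by blast
  have "bounded ((\<lambda>x. inverse (f x)) ` S)"
    using lipschitz_on_continuous_on[OF L] nz
    by (intro compact_imp_bounded compact_continuous_image assms(1) continuous_on_inverse) auto
  then obtain A where A: "\<And>x. x \<in> S \<Longrightarrow> \<bar>inverse (f x)\<bar> \<le> A" "0 < A"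
    by (auto simp: bounded_pos)
  have "(A * A * L)-lipschitz_on S (\<lambda>x. inverse (f x))"
  proof (rule lipschitz_onI)
    fix x y assume xy: "x \<in> S" "y \<in> S"
    have "inverse (f x) - inverse (f y) = inverse (f x) * (inverse (f y) * (f y - f x))"
      using nz xy by (simp add: field_simps)
    then have "dist (inverse (f x)) (inverse (f y)) = \<bar>inverse (f x)\<bar> * (\<bar>inverse (f y)\<bar> * dist (f x) (f y))"
      by (simp add: dist_real_def abs_mult abs_minus_commute)
    also have "\<dots> \<le> A * (A * (L * dist x y))"
      using A xy lipschitz_onD[OF L xy]
      by (intro mult_mono) (auto intro: order_trans[OF zero_le_dist])
    finally show "dist (inverse (f x)) (inverse (f y)) \<le> A * A * L * dist x y"
      by (simp add: algebra_simps)
  next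
    show "0 \<le> A * A * L"
      using A lipschitz_on_nonneg[OF L] by simp
  qed
  then show ?thesis by blast
qed

lemma lipschitz_add:
  fixes f g :: "'a::metric_space \<Rightarrow> 'b::real_normed_vector"
  assumes "\<exists>L. L-lipschitz_on S f" and "\<exists>L. L-lipschitz_on S g"
  shows "\<exists>L. L-lipschitz_on S (\<lambda>x. f x + g x)"
  using assms lipschitz_on_add by blast

lemma lipschitz_diff:
  fixes f g :: "'a::metric_space \<Rightarrow> 'b::real_normed_vector"
  assumes "\<exists>L. L-lipschitz_on S f" and "\<exists>L. L-lipschitz_on S g"
  shows "\<exists>L. L-lipschitz_on S (\<lambda>x. f x - g x)"
  using assms lipschitz_on_diff by blast

lemma lipschitz_norm:
  fixes f :: "'a::metric_space \<Rightarrow> 'b::real_normed_vector"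
  assumes "\<exists>L. L-lipschitz_on S f"
  shows "\<exists>L. L-lipschitz_on S (\<lambda>x. norm (f x))"
proof -
  obtain L where L: "L-lipschitz_on S f" using assms by blast
  have "dist (norm (f x)) (norm (f y)) \<le> L * dist x y" if "x \<in> S" "y \<in> S" for x y
    using lipschitz_onD[OF L that] norm_triangle_ineq3[of "f x" "f y"] by (simp add: dist_norm)
  then have "L-lipschitz_on S (\<lambda>x. norm (f x))"
    using lipschitz_on_nonneg[OF L] by (rule lipschitz_onI)
  then show ?thesis by blast
qed

lemma lipschitz_id: "\<exists>L. L-lipschitz_on S (\<lambda>x. x)"
  and lipschitz_const: "\<exists>L. L-lipschitz_on S (\<lambda>x. c)"
  using lipschitz_on_id lipschitz_on_constant by blast+

lemmas lipschitz_mult = lipschitz_scaleR[where 'b = real, unfolded real_scaleR_def]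

lemmas lipschitz_ex_intros =
  lipschitz_scaleR lipschitz_mult lipschitz_inverse lipschitz_add lipschitz_diff lipschitz_norm
  lipschitz_id lipschitz_const

section \<open>The gradients of the energy\<close>

text \<open>\<open>grad\<close> is a definite description, so evaluating it needs uniqueness of the
  gradient.\<close>

lemma GDERIV_unique:
  assumes "GDERIV f x :> D" "GDERIV f x :> E"
  shows "D = E"
proof -
  have "(\<lambda>h. h \<bullet> D) = (\<lambda>h. h \<bullet> E)"
    using assms unfolding gderiv_def by (rule has_derivative_unique)
  then show ?thesis by (metis vector_eq_ldot)
qed

lemma grad_eqI: "GDERIV f x :> D \<Longrightarrow> grad f x = D"
  unfolding grad_def using GDERIV_unique by blast

text \<open>The energy does not depend on the labelling of the disclinations, so that only the first
  gradient has to be computed.\<close>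

lemma H_hat_commute: "H_hat s1 s2 x y = H_hat s2 s1 y x"
  by (simp add: H_hat_def Phi12_def norm_minus_commute algebra_simps)

lemma grad2_H_eq: "grad2_H s1 s2 x y = grad1_H s2 s1 y x"
  unfolding grad1_H_def grad2_H_def by (subst H_hat_commute) rule

text \<open>The denominator of \<open>Phi12\<close>. In complex notation it is
  \<open>|1 - conj(x) y|^2\<close>, which makes \<open>Phi12\<close> the square of the
  pseudo-hyperbolic distance.\<close>

definition pair_gap :: "real^2 \<Rightarrow> real^2 \<Rightarrow> real" where
  "pair_gap x y = (norm (x - y))\<^sup>2 + (1 - (norm x)\<^sup>2) * (1 - (norm y)\<^sup>2)"

lemma pair_gap_commute: "pair_gap x y = pair_gap y x"
  by (simp add: pair_gap_def norm_minus_commute mult.commute)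

text \<open>The first summand is positive by distinctness and the second is nonnegative. This
  version reaches the boundary of the disk for a fixed nonzero separation.\<close>

lemma pair_gap_pos_closed:
  assumes "norm x \<le> 1" "norm y \<le> 1" "x \<noteq> y"
  shows "0 < pair_gap x y"
  using assms by (auto simp: pair_gap_def power_le_one intro!: add_pos_nonneg mult_nonneg_nonneg)

lemma grad1_H_eq:
  assumes "x \<noteq> y" "0 < pair_gap x y"
  shows "grad1_H s1 s2 x y =
    - (2 * s1 * (s1 * (1 - (norm x)\<^sup>2) + s2 * (1 - (norm y)\<^sup>2))) *\<^sub>R x
    + (2 * s1 * s2) *\<^sub>R ((ln ((norm (x - y))\<^sup>2) - ln (pair_gap x y) + 1) *\<^sub>R (x - y)
        - ((norm (x - y))\<^sup>2 / pair_gap x y) *\<^sub>R (x - y - (1 - (norm y)\<^sup>2) *\<^sub>R x))"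
  unfolding grad1_H_def
proof (rule grad_eqI)
  define N where "N = (\<lambda>z. (z - y) \<bullet> (z - y))"
  define G where "G = (\<lambda>z. N z + (1 - z \<bullet> z) * (1 - y \<bullet> y))"
  \<comment> \<open>The energy with norms written as inner products and the logarithm of the
    quotient split into a difference, which makes differentiation mechanical. It agrees with
    \<open>H_hat\<close> where \<open>N\<close> and \<open>G\<close> are positive, an open set
    containing \<open>x\<close>.\<close>
  define E where "E = (\<lambda>z. 1/2 * s1^2 * (1 - z \<bullet> z)^2 + 1/2 * s2^2 * (1 - y \<bullet> y)^2
     + s1 * s2 * (1 - z \<bullet> z) * (1 - y \<bullet> y) + s1 * s2 * N z * (ln (N z) - ln (G z)))"
  have N: "0 < N x" and G: "0 < G x" and ne: "x \<noteq> y"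
    using assms by (auto simp: N_def G_def pair_gap_def power2_norm_eq_inner)
  have N': "(N has_derivative (\<lambda>h. h \<bullet> (2 *\<^sub>R (x - y)))) (at x)"
    unfolding N_def by (auto intro!: derivative_eq_intros simp: inner_commute algebra_simps)
  have G': "(G has_derivative (\<lambda>h. h \<bullet> (2 *\<^sub>R (x - y) - (2 * (1 - y \<bullet> y)) *\<^sub>R x))) (at x)"
    unfolding G_def by (rule derivative_eq_intros N' refl)+ (auto simp: inner_commute algebra_simps)
  have "(E has_derivative (\<lambda>h. h \<bullet> (- (2 * s1 * (s1 * (1 - x \<bullet> x) + s2 * (1 - y \<bullet> y))) *\<^sub>R x
    + (2 * s1 * s2) *\<^sub>R ((ln (N x) - ln (G x) + 1) *\<^sub>R (x - y)
        - (N x / G x) *\<^sub>R (x - y - (1 - y \<bullet> y) *\<^sub>R x))))) (at x)"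
    unfolding E_def
    apply (rule derivative_eq_intros N' G' N G refl)+
    apply (rule ext)
    using N G
    apply (simp add: inner_commute algebra_simps power2_eq_square)
    apply (simp add: divide_simps)
    done
  then have "(E has_derivative (\<lambda>h. h \<bullet> (- (2 * s1 * (s1 * (1 - (norm x)\<^sup>2) + s2 * (1 - (norm y)\<^sup>2))) *\<^sub>R x
    + (2 * s1 * s2) *\<^sub>R ((ln ((norm (x - y))\<^sup>2) - ln (pair_gap x y) + 1) *\<^sub>R (x - y)
        - ((norm (x - y))\<^sup>2 / pair_gap x y) *\<^sub>R (x - y - (1 - (norm y)\<^sup>2) *\<^sub>R x))))) (at x)"
    by (simp only: N_def G_def pair_gap_def power2_norm_eq_inner)
  then show "GDERIV (\<lambda>z. H_hat s1 s2 z y) x :>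
    - (2 * s1 * (s1 * (1 - (norm x)\<^sup>2) + s2 * (1 - (norm y)\<^sup>2))) *\<^sub>R x
    + (2 * s1 * s2) *\<^sub>R ((ln ((norm (x - y))\<^sup>2) - ln (pair_gap x y) + 1) *\<^sub>R (x - y)
        - ((norm (x - y))\<^sup>2 / pair_gap x y) *\<^sub>R (x - y - (1 - (norm y)\<^sup>2) *\<^sub>R x))"
    unfolding gderiv_def
  proof (rule has_derivative_transform_within_open)
    show "open {z. 0 < N z \<and> 0 < G z}"
      unfolding N_def G_def by (intro open_Collect_conj open_Collect_less continuous_intros)
    show "x \<in> {z. 0 < N z \<and> 0 < G z}" using N G by simp
    show "E z = H_hat s1 s2 z y" if "z \<in> {z. 0 < N z \<and> 0 < G z}" for z
      using that by (simp add: E_def H_hat_def Phi12_def N_def G_def power2_norm_eq_inner ln_divide_pos)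
  qed
qed

text \<open>\<open>drift\<close> and \<open>multiplier\<close> are the velocity and the multiplier of the decoupled system in a form that
  is also meaningful at \<open>eps = 0\<close>, where the energy is singular. In \<open>multiplier\<close> the logarithm of
  \<open>Phi12\<close> is split because \<open>ln (pair_gap x y)\<close> is continuous at \<open>eps = 0\<close>, whereas \<open>ln ((norm eps)\<^sup>2)\<close>
  (with the junk value \<open>ln 0 = 0\<close>) is only so after multiplication by \<open>eps\<close>.\<close>

definition drift :: "real \<Rightarrow> real \<Rightarrow> real^2 \<Rightarrow> real^2 \<Rightarrow> real^2" where
  "drift s1 s2 eps x =
     (let y = x - eps; a = 1 - (norm x)\<^sup>2; b = 1 - (norm y)\<^sup>2 in
       (s1 * (s1 * a + s2 * b)) *\<^sub>R x + (s2 * (s1 * a + s2 * b)) *\<^sub>R y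
       - (s1 * s2 * (norm eps)\<^sup>2 * inverse (pair_gap x y)) *\<^sub>R (b *\<^sub>R x + a *\<^sub>R y))"

definition multiplier :: "real \<Rightarrow> real \<Rightarrow> real^2 \<Rightarrow> real^2 \<Rightarrow> real^2" where
  "multiplier s1 s2 eps x =
     (let y = x - eps; a = 1 - (norm x)\<^sup>2; b = 1 - (norm y)\<^sup>2 in
       (2 * s2 * (s1 * a + s2 * b)) *\<^sub>R y
       + (2 * s1 * s2) *\<^sub>R (ln ((norm eps)\<^sup>2) *\<^sub>R eps + (1 - ln (pair_gap x y)) *\<^sub>R eps
           - ((norm eps)\<^sup>2 * inverse (pair_gap x y)) *\<^sub>R (eps + a *\<^sub>R y))
       - drift s1 s2 eps x)"

text \<open>The logarithm multiplies \<open>x - y\<close> in one gradient and \<open>y - x\<close>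
  in the other, so it cancels in the sum.\<close>

lemma decoupled_velocity_eq:
  assumes "eps \<noteq> 0" "0 < pair_gap x (x - eps)"
  shows "decoupled_velocity s1 s2 eps x = drift s1 s2 eps x"
proof -
  have "grad1_H s1 s2 x (x - eps) + grad2_H s1 s2 x (x - eps) = - (2 *\<^sub>R drift s1 s2 eps x)"
    using assms
    by (simp add: drift_def grad2_H_eq grad1_H_eq Let_def pair_gap_commute[of "x - eps" x] divide_inverse algebra_simps)
  then show ?thesis by (simp add: decoupled_velocity_def)
qed

lemma multiplier_eq:
  assumes "eps \<noteq> 0" "0 < pair_gap x (x - eps)"
  shows "- grad2_H s1 s2 x (x - eps) - drift s1 s2 eps x = multiplier s1 s2 eps x"
  using assms
  by (simp add: multiplier_def grad2_H_eq grad1_H_eq Let_def pair_gap_commute[of "x - eps" x] divide_inverse algebra_simps)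

lemma drift_0: "drift s1 s2 0 x = ((s1 + s2)\<^sup>2 * (1 - (norm x)\<^sup>2)) *\<^sub>R x"
  unfolding drift_def Let_def
  by (simp flip: scaleR_add_left) (simp add: algebra_simps power2_eq_square)

text \<open>Coincident points share the weight \<open>1 - |x|^2\<close>, and its coefficient is
  \<open>2 s2 (s1 + s2) - (s1 + s2)^2 = s2^2 - s1^2\<close>.\<close>

lemma multiplier_0: "multiplier s1 s2 0 x = ((s2\<^sup>2 - s1\<^sup>2) * (1 - (norm x)\<^sup>2)) *\<^sub>R x"
  unfolding multiplier_def drift_0 Let_def
  by (simp flip: scaleR_diff_left) (simp add: algebra_simps power2_eq_square)

lemma lipschitz_drift:
  assumes "compact S" "\<And>x. x \<in> S \<Longrightarrow> pair_gap x (x - eps) \<noteq> 0"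
  shows "\<exists>L. L-lipschitz_on S (drift s1 s2 eps)"
  using assms(2)
  unfolding drift_def Let_def pair_gap_def power2_eq_square
  by (intro lipschitz_ex_intros assms(1)) auto

text \<open>At \<open>eps = 0\<close> the gap is \<open>(1 - |x|^2)^2\<close>, which vanishes on the
  circle, but it has dropped out of the field. What remains is polynomial, hence Lipschitz on balls
  of every radius.\<close>

lemma lipschitz_drift_0: "\<exists>L. L-lipschitz_on (cball 0 r) (drift s1 s2 0)"
  unfolding drift_0 power2_eq_square
  by (intro lipschitz_ex_intros compact_cball)

text \<open>At 0 the factor \<open>z\<close> outweighs the logarithm, and the value assigned to
  \<open>ln 0\<close> is multiplied by 0.\<close>

lemma continuous_ln_scaleR:
  fixes z :: "'a::real_normed_vector"
  shows "isCont (\<lambda>z :: 'a. ln ((norm z)\<^sup>2) *\<^sub>R z) z"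
proof (cases "z = 0")
  case False
  then show ?thesis by (intro continuous_intros) auto
next
  case True
  have "((\<lambda>t::real. ln (t\<^sup>2) * t) \<longlongrightarrow> 0) (at_right 0)" by real_asymp
  moreover have "filterlim norm (at_right 0) (at (0::'a))"
    by (auto simp: filterlim_at intro!: tendsto_eq_intros eventually_at_filter[THEN iffD2])
  ultimately have "((\<lambda>z::'a. ln ((norm z)\<^sup>2) * norm z) \<longlongrightarrow> 0) (at 0)"
    by (rule filterlim_compose)
  then have "((\<lambda>z::'a. norm (ln ((norm z)\<^sup>2) *\<^sub>R z)) \<longlongrightarrow> 0) (at 0)"
    by (auto dest: tendsto_rabs_zero simp: abs_mult)
  then have "((\<lambda>z::'a. ln ((norm z)\<^sup>2) *\<^sub>R z) \<longlongrightarrow> 0) (at 0)"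
    by (rule tendsto_norm_zero_cancel)
  then show ?thesis
    using True by (simp add: isCont_def)
qed

text \<open>Joint continuity in \<open>(eps, x)\<close> becomes uniform continuity on compact sets,
  and this is the source of all estimates uniform in \<open>x\<close> as \<open>eps\<close> tends to
  0.\<close>

lemma continuous_drift_multiplier:
  assumes "\<And>eps x. (eps, x) \<in> A \<Longrightarrow> 0 < pair_gap x (x - eps)"
  shows "continuous_on A (\<lambda>(eps, x). drift s1 s2 eps x)"
    and "continuous_on A (\<lambda>(eps, x). multiplier s1 s2 eps x)"
proof -
  have gap: "continuous_on A (\<lambda>p. pair_gap (snd p) (snd p - fst p))"
    unfolding pair_gap_def by (intro continuous_intros)
  have pos: "pair_gap (snd p) (snd p - fst p) \<noteq> 0" "0 < pair_gap (snd p) (snd p - fst p)" if "p \<in> A" for p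
    using assms[of "fst p" "snd p"] that by auto
  have ln: "continuous_on A (\<lambda>p. ln ((norm (fst p))\<^sup>2) *\<^sub>R fst p)"
    by (rule continuous_on_compose2[of UNIV "\<lambda>z. ln ((norm z)\<^sup>2) *\<^sub>R z"])
      (auto intro: continuous_at_imp_continuous_on continuous_ln_scaleR continuous_intros)
  show D: "continuous_on A (\<lambda>(eps, x). drift s1 s2 eps x)"
    unfolding drift_def Let_def case_prod_beta
    by (intro continuous_intros gap ballI pos)
  show "continuous_on A (\<lambda>(eps, x). multiplier s1 s2 eps x)"
    using D unfolding multiplier_def Let_def case_prod_beta
    by (intro continuous_intros gap ln ballI pos) auto
qed

text \<open>Here the second summand is positive, so coincident points, that is
  \<open>eps = 0\<close>, are covered.\<close>

lemma pair_gap_pos_open: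
  assumes "norm x < 1" "norm y < 1"
  shows "0 < pair_gap x y"
  using assms by (auto simp: pair_gap_def power_less_one_iff intro!: add_nonneg_pos mult_pos_pos)

section \<open>Solutions of the constrained system\<close>

text \<open>The constraint is imposed on this set; its openness permits differentiating the
  constraint at each of its times.\<close>

lemma open_time_domain: "open {T::real. 0 < T \<and> ereal T < \<tau>}"
proof (cases \<tau>)
  case (real r)
  then have "{T. 0 < T \<and> ereal T < \<tau>} = {0<..<r}" by auto
  then show ?thesis by simp
next
  case PInf
  then have "{T. 0 < T \<and> ereal T < \<tau>} = {0<..}" by auto
  then show ?thesis by simp
qed simp

lemma ereal_le_less_trans: "s \<le> t \<Longrightarrow> ereal t < \<tau> \<Longrightarrow> ereal s < \<tau>"
  by (rule le_less_trans[of _ "ereal t"]) auto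

text \<open>Differentiating the constraint equates the two velocities and gives
  \<open>2 lam = g1 - g2\<close>; substitution leaves minus the mean of the gradients as the common
  velocity.\<close>

lemma constrained_imp_decoupled:
  assumes sol: "constrained_solution s1 s2 eps xi0 \<tau> X1 X2 lam"
  shows "decoupled_solution s1 s2 eps xi0 \<tau> X1 X2 lam"
proof -
  have adm: "admissible_path eps xi0 \<tau> X1 X2"
    using sol by (simp add: constrained_solution_def)
  have "(X1 has_vector_derivative decoupled_velocity s1 s2 eps (X1 T)) (at T) \<and>
        (X2 has_vector_derivative decoupled_velocity s1 s2 eps (X1 T)) (at T) \<and>
        lam T = - grad2_H s1 s2 (X1 T) (X1 T - eps) - decoupled_velocity s1 s2 eps (X1 T)"
    if T: "0 < T" "ereal T < \<tau>" for T
  proof -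
    define g1 where "g1 = grad1_H s1 s2 (X1 T) (X2 T)"
    define g2 where "g2 = grad2_H s1 s2 (X1 T) (X2 T)"
    have d: "(X1 has_vector_derivative (- g1 + lam T)) (at T)"
            "(X2 has_vector_derivative (- g2 - lam T)) (at T)" and c: "X1 T - X2 T - eps = 0"
      using sol T by (auto simp: constrained_solution_def g1_def g2_def)
    have X2: "X2 T = X1 T - eps" using c by (simp add: algebra_simps)
    have "((\<lambda>T. X1 T - X2 T) has_vector_derivative 0) (at T)"
    proof (rule has_vector_derivative_transform_within_open)
      show "((\<lambda>_. eps) has_vector_derivative 0) (at T)" by simp
      show "open {T. 0 < T \<and> ereal T < \<tau>}" by (rule open_time_domain)
      show "eps = X1 t - X2 t" if "t \<in> {T. 0 < T \<and> ereal T < \<tau>}" for t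
        using sol that by (simp add: constrained_solution_def)
    qed (use T in simp)
    moreover have "((\<lambda>T. X1 T - X2 T) has_vector_derivative (- g1 + lam T) - (- g2 - lam T)) (at T)"
      by (intro has_vector_derivative_diff d)
    ultimately have "(- g1 + lam T) - (- g2 - lam T) = 0"
      by (blast intro: vector_derivative_unique_at)
    then have "g1 - g2 = 2 *\<^sub>R lam T" by (simp add: scaleR_2 algebra_simps)
    then have lam: "lam T = (1/2) *\<^sub>R (g1 - g2)" by simp
    have v: "decoupled_velocity s1 s2 eps (X1 T) = - ((1/2) *\<^sub>R (g1 + g2))"
      by (simp add: decoupled_velocity_def g1_def g2_def X2)
    have half: "g = (1/2) *\<^sub>R g + (1/2) *\<^sub>R g" for g :: "real^2"
      by (simp flip: scaleR_add_left)
    have "- g1 + lam T = decoupled_velocity s1 s2 eps (X1 T)"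
      "- g2 - lam T = decoupled_velocity s1 s2 eps (X1 T)"
      unfolding v lam using half[of g1] half[of g2] by (simp_all add: algebra_simps)
    then show ?thesis using d
      by (auto simp: g2_def X2 algebra_simps)
  qed
  then show ?thesis using adm by (simp add: decoupled_solution_def)
qed

text \<open>Equal velocities keep the difference of the positions constant, and the initial values
  make it \<open>eps\<close>; this is uniqueness for the zero field.\<close>

lemma decoupled_constraint:
  assumes sol: "decoupled_solution s1 s2 eps xi0 \<tau> X1 X2 lam" and T: "0 \<le> T" "ereal T < \<tau>"
  shows "X2 T = X1 T - eps"
proof -
  have sub: "{0..T} \<subseteq> {T. 0 \<le> T \<and> ereal T < \<tau>}"
    using T by (auto intro: ereal_le_less_trans)
  have X: "continuous_on {0..T} X1" "continuous_on {0..T} X2" "X1 0 = xi0" "X2 0 = xi0 - eps"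
    using sol sub by (auto simp: decoupled_solution_def admissible_path_def intro: continuous_on_subset)
  have "(\<lambda>t. X1 t - X2 t) T = (\<lambda>_. eps) T"
  proof (rule ode_unique[where L = 0 and S = UNIV and f = "\<lambda>_. 0"])
    fix t assume t: "0 < t" "t < T"
    then have "ereal t < \<tau>" using ereal_le_less_trans[OF _ T(2), of t] by simp
    then have "((\<lambda>t. X1 t - X2 t) has_vector_derivative
        decoupled_velocity s1 s2 eps (X1 t) - decoupled_velocity s1 s2 eps (X1 t)) (at t)"
      using sol t by (intro has_vector_derivative_diff) (auto simp: decoupled_solution_def)
    then show "((\<lambda>t. X1 t - X2 t) has_vector_derivative 0) (at t)" by simp
  qed (use T X in \<open>auto intro!: continuous_intros lipschitz_on_constant\<close>)
  then show ?thesis by (simp add: algebra_simps)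
qed

lemma decoupled_imp_constrained:
  assumes sol: "decoupled_solution s1 s2 eps xi0 \<tau> X1 X2 lam"
  shows "constrained_solution s1 s2 eps xi0 \<tau> X1 X2 lam"
proof -
  have "(X1 has_vector_derivative (- grad1_H s1 s2 (X1 T) (X2 T) + lam T)) (at T) \<and>
        (X2 has_vector_derivative (- grad2_H s1 s2 (X1 T) (X2 T) - lam T)) (at T) \<and>
        X1 T - X2 T - eps = 0"
    if T: "0 < T" "ereal T < \<tau>" for T
  proof -
    define g1 where "g1 = grad1_H s1 s2 (X1 T) (X2 T)"
    define g2 where "g2 = grad2_H s1 s2 (X1 T) (X2 T)"
    have X2: "X2 T = X1 T - eps"
      using decoupled_constraint[OF sol] T by simp
    have v: "decoupled_velocity s1 s2 eps (X1 T) = - ((1/2) *\<^sub>R (g1 + g2))"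
      by (simp add: decoupled_velocity_def g1_def g2_def X2)
    have lam: "lam T = - g2 - decoupled_velocity s1 s2 eps (X1 T)"
      using sol T by (simp add: decoupled_solution_def g2_def X2)
    have half: "g = (1/2) *\<^sub>R g + (1/2) *\<^sub>R g" for g :: "real^2"
      by (simp flip: scaleR_add_left)
    have "- g1 + lam T = decoupled_velocity s1 s2 eps (X1 T)"
      "- g2 - lam T = decoupled_velocity s1 s2 eps (X1 T)"
      unfolding lam v using half[of g1] half[of g2] by (simp_all add: algebra_simps)
    moreover have "(X1 has_vector_derivative decoupled_velocity s1 s2 eps (X1 T)) (at T)"
      "(X2 has_vector_derivative decoupled_velocity s1 s2 eps (X1 T)) (at T)"
      using sol T by (auto simp: decoupled_solution_def)
    ultimately show ?thesis
      unfolding g1_def[symmetric] g2_def[symmetric] by (simp add: X2)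
  qed
  then show ?thesis using sol by (simp add: constrained_solution_def decoupled_solution_def)
qed

lemma constrained_iff_decoupled:
  "constrained_solution s1 s2 eps xi0 \<tau> X1 X2 lam \<longleftrightarrow>
   decoupled_solution s1 s2 eps xi0 \<tau> X1 X2 lam"
  using constrained_imp_decoupled decoupled_imp_constrained by blast

lemma constrained_solutionI:
  assumes "eps \<noteq> 0" "0 < \<tau>" and "continuous_on {0..} Z" "Z 0 = xi0"
    and Z': "\<And>T. 0 < T \<Longrightarrow> ereal T < \<tau> \<Longrightarrow> (Z has_vector_derivative drift s1 s2 eps (Z T)) (at T)"
    and disk: "\<And>T. 0 \<le> T \<Longrightarrow> ereal T < \<tau> \<Longrightarrow> Z T \<in> ball 0 1 \<and> Z T - eps \<in> ball 0 1"
  shows "constrained_solution s1 s2 eps xi0 \<tau> Z (\<lambda>T. Z T - eps) (\<lambda>T. multiplier s1 s2 eps (Z T))"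
  unfolding constrained_iff_decoupled decoupled_solution_def
proof (intro conjI allI impI)
  have "continuous_on {T. 0 \<le> T \<and> ereal T < \<tau>} Z"
    using assms(3) by (rule continuous_on_subset) auto
  then show "admissible_path eps xi0 \<tau> Z (\<lambda>T. Z T - eps)"
    using assms by (auto simp: admissible_path_def intro!: continuous_intros)
  fix T assume T: "0 < T \<and> ereal T < \<tau>"
  then have gap: "0 < pair_gap (Z T) (Z T - eps)"
    using disk[of T] by (auto intro!: pair_gap_pos_open)
  note v = decoupled_velocity_eq[OF \<open>eps \<noteq> 0\<close> gap, of s1 s2]
  show d: "(Z has_vector_derivative decoupled_velocity s1 s2 eps (Z T)) (at T)"
    unfolding v using Z' T by blast
  show "((\<lambda>T. Z T - eps) has_vector_derivative decoupled_velocity s1 s2 eps (Z T)) (at T)"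
    using has_vector_derivative_diff[OF d has_vector_derivative_const[of eps]] by simp
  show "multiplier s1 s2 eps (Z T)
      = - grad2_H s1 s2 (Z T) (Z T - eps) - decoupled_velocity s1 s2 eps (Z T)"
    unfolding v by (rule multiplier_eq[OF \<open>eps \<noteq> 0\<close> gap, symmetric])
qed

lemma constrained_solutionD:
  assumes sol: "constrained_solution s1 s2 eps xi0 \<tau> X1 X2 lam" and T: "0 \<le> T" "ereal T < \<tau>"
  shows "X2 T = X1 T - eps" "norm (X1 T) < 1" "norm (X1 T - eps) < 1"
    "X1 0 = xi0" "continuous_on {0..T} X1"
    "eps \<noteq> 0 \<Longrightarrow> 0 < T \<Longrightarrow> (X1 has_vector_derivative drift s1 s2 eps (X1 T)) (at T)"
    "eps \<noteq> 0 \<Longrightarrow> 0 < T \<Longrightarrow> lam T = multiplier s1 s2 eps (X1 T)"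
proof -
  have dec: "decoupled_solution s1 s2 eps xi0 \<tau> X1 X2 lam"
    using sol by (simp add: constrained_iff_decoupled)
  show X2: "X2 T = X1 T - eps" by (rule decoupled_constraint[OF dec T])
  have "X1 T \<in> ball 0 1" "X2 T \<in> ball 0 1"
    using dec T by (auto simp: decoupled_solution_def admissible_path_def)
  then show n: "norm (X1 T) < 1" "norm (X1 T - eps) < 1"
    by (auto simp: X2)
  have "{0..T} \<subseteq> {T. 0 \<le> T \<and> ereal T < \<tau>}"
    using T by (auto intro: ereal_le_less_trans)
  then show "continuous_on {0..T} X1" "X1 0 = xi0"
    using dec by (auto simp: decoupled_solution_def admissible_path_def intro: continuous_on_subset)
  assume "eps \<noteq> 0" "0 < T"
  have gap: "0 < pair_gap (X1 T) (X1 T - eps)" using n by (rule pair_gap_pos_open)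
  have v: "(X1 has_vector_derivative decoupled_velocity s1 s2 eps (X1 T)) (at T)"
    and l: "lam T = - grad2_H s1 s2 (X1 T) (X1 T - eps) - decoupled_velocity s1 s2 eps (X1 T)"
    using dec T \<open>0 < T\<close> by (auto simp: decoupled_solution_def)
  show "(X1 has_vector_derivative drift s1 s2 eps (X1 T)) (at T)"
    using v unfolding decoupled_velocity_eq[OF \<open>eps \<noteq> 0\<close> gap] .
  show "lam T = multiplier s1 s2 eps (X1 T)"
    using l unfolding decoupled_velocity_eq[OF \<open>eps \<noteq> 0\<close> gap] multiplier_eq[OF \<open>eps \<noteq> 0\<close> gap] .
qed

text \<open>For fixed \<open>eps \<noteq> 0\<close> the field is regular up to the boundary of the lens where both points lie in
  the disk: there \<open>pair_gap x (x - eps) \<ge> |eps|\<^sup>2\<close>. Hence it extends to a globally Lipschitz field by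
  composition with the projection onto the lens, and the maximal solution is the global trajectory of
  the extended field, stopped when it leaves the open lens.\<close>

lemma lipschitz_drift_lens:
  assumes "eps \<noteq> 0" "S \<subseteq> cball 0 1 \<inter> cball eps 1" "compact S"
  shows "\<exists>L. L-lipschitz_on S (drift s1 s2 eps)"
proof (rule lipschitz_drift[OF assms(3)])
  fix x assume "x \<in> S"
  then have "0 < pair_gap x (x - eps)"
    using assms by (intro pair_gap_pos_closed) (auto simp: dist_norm norm_minus_commute)
  then show "pair_gap x (x - eps) \<noteq> 0" by simp
qed

text \<open>Both trajectories lie in the lens, where the drift for this \<open>eps\<close> is
  Lipschitz, and the multiplier is a function of the position.\<close>

lemma constrained_unique:
  assumes "eps \<noteq> 0"
    and X: "constrained_solution s1 s2 eps xi0 \<tau> X1 X2 lam"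
    and Y: "constrained_solution s1 s2 eps xi0 \<tau>' Y1 Y2 mu"
    and T: "0 \<le> T" "ereal T < \<tau>" "ereal T < \<tau>'"
  shows "X1 T = Y1 T" "X2 T = Y2 T" "0 < T \<Longrightarrow> lam T = mu T"
proof -
  let ?S = "cball 0 1 \<inter> cball eps 1"
  obtain L where L: "L-lipschitz_on ?S (drift s1 s2 eps)"
    using lipschitz_drift_lens[OF \<open>eps \<noteq> 0\<close>, of ?S] by (auto simp: compact_Int)
  show eq: "X1 T = Y1 T"
  proof (rule ode_unique[OF T(1) L])
    fix t assume t: "0 < t" "t < T"
    then have *: "0 \<le> t" "ereal t < \<tau>" "ereal t < \<tau>'"
      using ereal_le_less_trans[OF _ T(2), of t] ereal_le_less_trans[OF _ T(3), of t] by auto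
    show "(X1 has_vector_derivative drift s1 s2 eps (X1 t)) (at t)"
      "(Y1 has_vector_derivative drift s1 s2 eps (Y1 t)) (at t)"
      using * t \<open>eps \<noteq> 0\<close> X Y by (auto intro: constrained_solutionD)
    show "X1 t \<in> ?S" "Y1 t \<in> ?S"
      using constrained_solutionD(2,3)[OF X *(1,2)] constrained_solutionD(2,3)[OF Y *(1,3)]
      by (auto simp: dist_norm norm_minus_commute)
  qed (use constrained_solutionD(4,5)[OF X T(1,2)] constrained_solutionD(4,5)[OF Y T(1,3)] in auto)
  show "X2 T = Y2 T"
    using eq constrained_solutionD(1)[OF X T(1,2)] constrained_solutionD(1)[OF Y T(1,3)] by simp
  show "lam T = mu T" if "0 < T"
    using eq that \<open>eps \<noteq> 0\<close> constrained_solutionD(7)[OF X T(1,2)] constrained_solutionD(7)[OF Y T(1,3)]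
    by simp
qed

text \<open>Projection onto a closed convex set is nonexpansive, so the constant is
  unchanged.\<close>

lemma lipschitz_closest_point:
  fixes f :: "'a::euclidean_space \<Rightarrow> 'b::metric_space"
  assumes "convex S" "closed S" "S \<noteq> {}" and L: "L-lipschitz_on S f"
  shows "L-lipschitz_on UNIV (\<lambda>x. f (closest_point S x))"
proof -
  have "1-lipschitz_on UNIV (closest_point S)"
    by (rule lipschitz_onI) (use closest_point_lipschitz[OF assms(1-3)] in auto)
  moreover have "L-lipschitz_on (closest_point S ` UNIV) f"
    using L by (rule lipschitz_on_subset) (use closest_point_in_set assms in auto)
  ultimately show ?thesis
    using lipschitz_on_compose2[of 1 UNIV "closest_point S" L f] by simp
qed

lemma maximal_constrained_solution_exists:
  assumes "eps \<noteq> 0" "xi0 \<in> ball 0 1" "xi0 - eps \<in> ball 0 1"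
  shows "\<exists>\<tau> X1 X2 lam. maximal_constrained_solution s1 s2 eps xi0 \<tau> X1 X2 lam"
proof -
  define S where "S = cball 0 1 \<inter> cball eps 1"
  define U where "U = ball 0 1 \<inter> ball eps 1"
  have U: "z \<in> U \<longleftrightarrow> z \<in> ball 0 1 \<and> z - eps \<in> ball 0 1" for z
    by (auto simp: U_def dist_norm norm_minus_commute)
  have US: "U \<subseteq> S" by (auto simp: U_def S_def)
  have xi0: "xi0 \<in> U" using assms by (simp add: U)
  have S: "convex S" "closed S" "S \<noteq> {}" "compact S"
    using xi0 US by (auto simp: S_def convex_Int compact_Int)
  obtain L where L: "L-lipschitz_on S (drift s1 s2 eps)"
    using lipschitz_drift_lens[OF \<open>eps \<noteq> 0\<close> _ S(4)] by (auto simp: S_def)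
  define f where "f = (\<lambda>x. drift s1 s2 eps (closest_point S x))"
  have Lf: "L-lipschitz_on UNIV f"
    unfolding f_def by (rule lipschitz_closest_point[OF S(1-3) L])
  have f: "f x = drift s1 s2 eps x" if "x \<in> U" for x
    using that US by (auto simp: f_def closest_point_self)
  obtain Z where Z: "Z 0 = xi0" "continuous_on {0..} Z"
    "\<And>t. 0 < t \<Longrightarrow> (Z has_vector_derivative f (Z t)) (at t)"
    using ode_global_existence[OF Lf] by metis
  have sol: "constrained_solution s1 s2 eps xi0 \<tau> Z (\<lambda>T. Z T - eps) (\<lambda>T. multiplier s1 s2 eps (Z T))"
    if "0 < \<tau>" "\<And>T. 0 \<le> T \<Longrightarrow> ereal T < \<tau> \<Longrightarrow> Z T \<in> U" for \<tau>
  proof (rule constrained_solutionI)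
    show "(Z has_vector_derivative drift s1 s2 eps (Z T)) (at T)" if "0 < T" "ereal T < \<tau>" for T
      using Z(3)[of T] that f[of "Z T"] \<open>\<And>T. 0 \<le> T \<Longrightarrow> ereal T < \<tau> \<Longrightarrow> Z T \<in> U\<close>[of T] by simp
    show "Z T \<in> ball 0 1 \<and> Z T - eps \<in> ball 0 1" if "0 \<le> T" "ereal T < \<tau>" for T
      using \<open>\<And>T. 0 \<le> T \<Longrightarrow> ereal T < \<tau> \<Longrightarrow> Z T \<in> U\<close>[OF that] by (simp add: U)
  qed (use Z \<open>eps \<noteq> 0\<close> \<open>0 < \<tau>\<close> in auto)
  \<comment> \<open>Taking the supremum of all lifetimes, rather than an exit time of
    \<open>Z\<close>, makes maximality immediate; it remains to see that \<open>Z\<close> stays in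
    the open lens before \<open>\<sigma>\<close>.\<close>
  define \<sigma> where "\<sigma> = Sup {\<tau>. \<exists>Y1 Y2 mu. constrained_solution s1 s2 eps xi0 \<tau> Y1 Y2 mu}"
  have upper: "\<tau> \<le> \<sigma>" if "constrained_solution s1 s2 eps xi0 \<tau> Y1 Y2 mu" for \<tau> Y1 Y2 mu
    unfolding \<sigma>_def using that by (intro Sup_upper) auto
  have "open U" by (auto simp: U_def)
  then obtain e where e: "0 < e" "ball xi0 e \<subseteq> U" using xi0 open_contains_ball by blast
  obtain d where d: "0 < d" "\<And>t. 0 \<le> t \<Longrightarrow> t < d \<Longrightarrow> dist (Z t) xi0 < e"
    using Z(2)[unfolded continuous_on_iff, rule_format, of 0 e] e(1) Z(1) by (auto simp: dist_real_def)
  have "constrained_solution s1 s2 eps xi0 (ereal d) Z (\<lambda>T. Z T - eps) (\<lambda>T. multiplier s1 s2 eps (Z T))"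
    using d e by (intro sol) (auto simp: dist_commute subset_iff)
  then have "ereal d \<le> \<sigma>" by (rule upper)
  then have "0 < \<sigma>" using d(1) by (metis ereal_less(2) order_less_le_trans)
  have "Z T \<in> U" if T: "0 \<le> T" "ereal T < \<sigma>" for T
  proof -
    \<comment> \<open>Some solution outlives \<open>T\<close>. It stays in the lens, so it follows
      the extended field too and coincides with \<open>Z\<close> up to \<open>T\<close>.\<close>
    obtain \<tau> Y1 Y2 mu where Y: "constrained_solution s1 s2 eps xi0 \<tau> Y1 Y2 mu" and T\<tau>: "ereal T < \<tau>"
      using T(2) unfolding \<sigma>_def less_Sup_iff by auto
    have YU: "Y1 t \<in> U" if "0 \<le> t" "t \<le> T" for t
      using constrained_solutionD(2,3)[OF Y that(1)] ereal_le_less_trans[OF that(2) T\<tau>] by (simp add: U)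
    have "Z T = Y1 T"
    proof (rule ode_unique[OF T(1) Lf])
      show "continuous_on {0..T} Z" using Z(2) by (rule continuous_on_subset) auto
      fix t assume t: "0 < t" "t < T"
      then show "(Z has_vector_derivative f (Z t)) (at t)" using Z(3) by simp
      have "ereal t < \<tau>" using t ereal_le_less_trans[OF _ T\<tau>, of t] by simp
      then show "(Y1 has_vector_derivative f (Y1 t)) (at t)"
        using constrained_solutionD(6)[OF Y, of t] t YU[of t] \<open>eps \<noteq> 0\<close> by (simp add: f)
    qed (use Z(1) constrained_solutionD(4,5)[OF Y T(1) T\<tau>] in auto)
    then show ?thesis using YU[of T] T by simp
  qed
  then have "constrained_solution s1 s2 eps xi0 \<sigma> Z (\<lambda>T. Z T - eps) (\<lambda>T. multiplier s1 s2 eps (Z T))"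
    using \<open>0 < \<sigma>\<close> by (intro sol)
  then have "maximal_constrained_solution s1 s2 eps xi0 \<sigma> Z (\<lambda>T. Z T - eps) (\<lambda>T. multiplier s1 s2 eps (Z T))"
    using upper by (auto simp: maximal_constrained_solution_def)
  then show ?thesis by blast
qed

section \<open>The limit of vanishing separation\<close>

lemma eff_angle_sq: "2 * (eff_angle s1 s2)\<^sup>2 = (s1 + s2)\<^sup>2"
  by (simp add: eff_angle_def power_divide)

lemma limit_solution_iff:
  "limit_solution s1 s2 xi0 X lam \<longleftrightarrow>
     continuous_on {0..} X \<and> X 0 = xi0 \<and>
     (\<forall>T>0. (X has_vector_derivative drift s1 s2 0 (X T)) (at T) \<and> lam T = multiplier s1 s2 0 (X T))"
  by (simp add: limit_solution_def eff_angle_sq drift_0 multiplier_0)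

text \<open>The squared radius satisfies the logistic equation, which gives the closed form below.\<close>

lemma limit_solution_explicit:
  assumes "norm xi0 < 1"
  obtains X where "limit_solution s1 s2 xi0 X (\<lambda>T. multiplier s1 s2 0 (X T))"
    "\<And>T. norm (X T) < 1"
proof
  define c where "c = (s1 + s2)\<^sup>2"
  define u where "u = (norm xi0)\<^sup>2"
  \<comment> \<open>\<open>v = |X|^2\<close> satisfies \<open>v' = 2 c v (1 - v)\<close>, solved by
    \<open>u * exp (2 * c * T) / D T\<close>. The direction of \<open>xi0\<close> is preserved, and
    the factor in \<open>X\<close> is the square root of
    \<open>exp (2 * c * T) / D T\<close>.\<close>
  define D where "D = (\<lambda>T. 1 - u + u * exp (2 * c * T))"
  define X where "X = (\<lambda>T. (exp (c * T) / sqrt (D T)) *\<^sub>R xi0)"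
  have u: "0 \<le> u" "u < 1" using assms by (auto simp: u_def power_less_one_iff)
  then have D: "0 < D T" for T
    unfolding D_def by (intro add_pos_nonneg) auto
  have nX: "(norm (X T))\<^sup>2 = u * exp (2 * c * T) / D T" for T
  proof -
    have "(exp (c * T))\<^sup>2 = exp (2 * c * T)" by (simp add: power2_eq_square flip: exp_add)
    then show ?thesis
      using D[of T] by (simp add: X_def power_mult_distrib power_divide u_def)
  qed
  then have X1: "1 - (norm (X T))\<^sup>2 = (1 - u) / D T" for T
    using D[of T] by (simp add: D_def field_simps)
  show "norm (X T) < 1" for T
  proof -
    have "0 < 1 - (norm (X T))\<^sup>2" unfolding X1 using u D[of T] by simp
    then show ?thesis by (simp add: power_less_one_iff)
  qed
  have X': "(X has_vector_derivative drift s1 s2 0 (X T)) (at T)" for T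
  proof -
    have "((\<lambda>T. exp (c * T) / sqrt (D T)) has_real_derivative
        c * (1 - u) / D T * (exp (c * T) / sqrt (D T))) (at T)"
    proof -
      have D': "(D has_real_derivative u * (exp (2 * c * T) * (2 * c))) (at T)"
        unfolding D_def by (auto intro!: derivative_eq_intros)
      have "u * exp (2 * c * T) = D T - (1 - u)" by (simp add: D_def)
      then have D'': "(D has_real_derivative (D T - (1 - u)) * (2 * c)) (at T)"
        using D' by (simp add: mult.assoc[symmetric])
      define q where "q = sqrt (D T)"
      have q: "0 < q" and DT: "D T = q * q" using D[of T] by (simp_all add: q_def)
      have "((\<lambda>T. sqrt (D T)) has_real_derivative inverse q / 2 * ((D T - (1 - u)) * (2 * c))) (at T)"
        unfolding q_def by (rule DERIV_chain2[OF DERIV_real_sqrt[OF D] D''])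
      moreover have "((\<lambda>T. exp (c * T)) has_real_derivative exp (c * T) * c) (at T)"
        by (auto intro!: derivative_eq_intros)
      ultimately have "((\<lambda>T. exp (c * T) / sqrt (D T)) has_real_derivative
        (exp (c * T) * c * q - exp (c * T) * (inverse q / 2 * ((D T - (1 - u)) * (2 * c)))) / (q * q)) (at T)"
        using q unfolding q_def by (intro DERIV_divide) auto
      moreover have "(exp (c * T) * c * q - exp (c * T) * (inverse q / 2 * ((D T - (1 - u)) * (2 * c)))) / (q * q)
          = c * (1 - u) / D T * (exp (c * T) / q)"
        unfolding DT using q by (simp add: field_simps)
      ultimately show ?thesis unfolding q_def by metis
    qed
    then have "(X has_vector_derivative (c * (1 - u) / D T * (exp (c * T) / sqrt (D T))) *\<^sub>R xi0) (at T)"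
      unfolding X_def using has_vector_derivative_scaleR[OF _ has_vector_derivative_const[of xi0]] by fastforce
    then show ?thesis
      by (simp add: drift_0 X1) (simp add: X_def c_def)
  qed
  then have "continuous_on {0..} X"
    by (intro continuous_at_imp_continuous_on ballI has_vector_derivative_continuous)
  moreover have "X 0 = xi0" by (simp add: X_def D_def)
  ultimately show "limit_solution s1 s2 xi0 X (\<lambda>T. multiplier s1 s2 0 (X T))"
    using X' by (simp add: limit_solution_iff)
qed

lemma limit_solution_unique:
  assumes X: "limit_solution s1 s2 xi0 X lam" and Y: "limit_solution s1 s2 xi0 Y mu" and "0 \<le> T"
  shows "X T = Y T" "0 < T \<Longrightarrow> lam T = mu T"
proof -
  have c: "continuous_on {0..T} X" "continuous_on {0..T} Y"
    using X Y by (auto simp: limit_solution_def intro: continuous_on_subset)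
  \<comment> \<open>\<open>limit_solution\<close> does not confine the trajectory to the disk; a
    ball containing both trajectories comes from compactness of the time interval.\<close>
  then have "bounded (X ` {0..T} \<union> Y ` {0..T})"
    by (intro bounded_Un[THEN iffD2] conjI compact_imp_bounded compact_continuous_image) auto
  then obtain M where M: "\<And>z. z \<in> X ` {0..T} \<union> Y ` {0..T} \<Longrightarrow> norm z \<le> M"
    by (auto simp: bounded_iff)
  obtain L where L: "L-lipschitz_on (cball 0 M) (drift s1 s2 0)"
    using lipschitz_drift_0 by blast
  show eq: "X T = Y T"
    by (rule ode_unique[OF \<open>0 \<le> T\<close> L c]) (use X Y M in \<open>auto simp: limit_solution_iff\<close>)
  show "lam T = mu T" if "0 < T"
    using that X Y eq by (simp add: limit_solution_iff)
qed

text \<open>The comparison is made for the field composed with the projection onto the ball of radius \<open>r\<close>, where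
  closeness to the limit field holds everywhere; the estimate then shows a posteriori that the
  projection was inactive.\<close>

lemma constrained_near_limit:
  assumes xi0: "norm xi0 < 1" and "0 < T1" "0 < \<eta>" "r < 1"
    and X: "limit_solution s1 s2 xi0 X lam" and near: "\<And>T. 0 \<le> T \<Longrightarrow> T \<le> T1 \<Longrightarrow> norm (X T) + \<eta> \<le> r"
  shows "\<forall>\<^sub>F eps in at 0. \<exists>Z mu. constrained_solution s1 s2 eps xi0 (ereal T1) Z (\<lambda>T. Z T - eps) mu
    \<and> (\<forall>T\<in>{0..T1}. dist (Z T) (X T) < \<eta>)"
proof -
  have Xc: "continuous_on {0..} X" "X 0 = xi0"
    and X': "\<And>T. 0 < T \<Longrightarrow> (X has_vector_derivative drift s1 s2 0 (X T)) (at T)"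
    using X by (auto simp: limit_solution_iff)
  have "0 < r" using near[of 0] \<open>0 < T1\<close> \<open>0 < \<eta>\<close> norm_ge_zero[of "X 0"] by linarith
  \<comment> \<open>A shift by at most \<open>\<delta>\<close> takes radius \<open>r\<close> to at
    most \<open>(1 + r)/2 < 1\<close>.\<close>
  define \<delta> where "\<delta> = (1 - r) / 2"
  have \<delta>: "0 < \<delta>" using \<open>r < 1\<close> by (simp add: \<delta>_def)
  define S :: "(real^2) set" where "S = cball 0 r"
  have S: "convex S" "closed S" "S \<noteq> {}" "compact S" using \<open>0 < r\<close> by (auto simp: S_def)
  have disk: "norm x < 1" "norm (x - eps) < 1" if "norm eps \<le> \<delta>" "x \<in> S" for eps x
  proof -
    show "norm x < 1" using that \<open>r < 1\<close> by (simp add: S_def)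
    have "norm (x - eps) \<le> norm x + norm eps" by (rule norm_triangle_ineq4)
    then show "norm (x - eps) < 1" using that \<open>r < 1\<close> by (simp add: S_def \<delta>_def field_simps)
  qed
  define B where "B = cball (0::real^2) \<delta> \<times> S"
  have "uniformly_continuous_on B (\<lambda>(eps, x). drift s1 s2 eps x)"
    by (intro compact_uniformly_continuous continuous_drift_multiplier)
      (auto simp: B_def S intro!: pair_gap_pos_open disk compact_Times)
  note uc = this[unfolded uniformly_continuous_on_def, rule_format]
  obtain L where L: "L-lipschitz_on S (drift s1 s2 0)"
    using lipschitz_drift_0 unfolding S_def by blast
  have "0 \<le> L" using L by (rule lipschitz_on_nonneg)
  define C where "C = T1 * exp ((2 * L + 1) * T1)"
  have "0 < C" using \<open>0 < T1\<close> by (simp add: C_def)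
  \<comment> \<open>Chosen so that \<open>e^2 * C = \<eta>^2 / 2\<close>, where \<open>C\<close> is
    the factor of the comparison estimate at time \<open>T1\<close>.\<close>
  define e where "e = \<eta> / sqrt (2 * C)"
  have e: "0 < e" "e\<^sup>2 * C < \<eta>\<^sup>2" using \<open>0 < \<eta>\<close> \<open>0 < C\<close> by (auto simp: e_def power_divide)
  obtain d where d: "0 < d" and
    close: "\<And>eps x. norm eps \<le> \<delta> \<Longrightarrow> x \<in> S \<Longrightarrow> norm eps < d \<Longrightarrow> norm (drift s1 s2 eps x - drift s1 s2 0 x) < e"
  proof -
    obtain d where "0 < d" and d: "\<And>p q. p \<in> B \<Longrightarrow> q \<in> B \<Longrightarrow> dist q p < d \<Longrightarrow>
      dist (case q of (eps, x) \<Rightarrow> drift s1 s2 eps x) (case p of (eps, x) \<Rightarrow> drift s1 s2 eps x) < e"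
      using uc[OF e(1)] by metis
    have "norm (drift s1 s2 eps x - drift s1 s2 0 x) < e" if "norm eps \<le> \<delta>" "x \<in> S" "norm eps < d" for eps x
      using d[of "(0, x)" "(eps, x)"] that \<delta> by (simp add: B_def dist_Pair_Pair) (simp add: dist_norm)
    with \<open>0 < d\<close> show thesis by (rule that)
  qed
  have "\<exists>Z mu. constrained_solution s1 s2 eps xi0 (ereal T1) Z (\<lambda>T. Z T - eps) mu
      \<and> (\<forall>T\<in>{0..T1}. dist (Z T) (X T) < \<eta>)"
    if eps: "eps \<noteq> 0" "norm eps < \<delta>" "norm eps < d" for eps :: "real^2"
  proof -
    define f where "f = (\<lambda>x. drift s1 s2 eps (closest_point S x))"
    have cp: "closest_point S x \<in> S" for x using S closest_point_in_set by blast
    have "pair_gap x (x - eps) \<noteq> 0" if "x \<in> S" for x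
      using pair_gap_pos_open[OF disk(1)[of eps x] disk(2)[of eps x]] that eps by simp
    \<comment> \<open>\<open>L'\<close> may depend on \<open>eps\<close> and serves the existence of
      \<open>Z\<close>. The comparison below uses the constant \<open>L\<close> of the limit field,
      common to all \<open>eps\<close>.\<close>
    then obtain L' where "L'-lipschitz_on S (drift s1 s2 eps)"
      using lipschitz_drift[OF S(4)] by blast
    then have "L'-lipschitz_on UNIV f"
      unfolding f_def using S by (intro lipschitz_closest_point)
    then obtain Z where Z: "Z 0 = xi0" "continuous_on {0..} Z"
      "\<And>t. 0 < t \<Longrightarrow> (Z has_vector_derivative f (Z t)) (at t)"
      using ode_global_existence by metis
    have XS: "X t \<in> S" if "0 \<le> t" "t \<le> T1" for t
      using near[OF that] \<open>0 < \<eta>\<close> by (simp add: S_def)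
    have dist: "dist (Z T) (X T) < \<eta>" if T: "0 \<le> T" "T \<le> T1" for T
    proof -
      have "(norm (Z T - X T))\<^sup>2 \<le> e\<^sup>2 * T * exp ((2 * L + 1) * T)"
      proof (rule ode_comparison[where p = "\<lambda>t. f (Z t)" and q = "\<lambda>t. drift s1 s2 0 (X t)"])
        fix t assume t: "0 < t" "t < T"
        have Xt: "closest_point S (X t) = X t" using XS[of t] t T by (simp add: closest_point_self)
        have "norm (drift s1 s2 0 (closest_point S (Z t)) - drift s1 s2 0 (X t))
            \<le> L * norm (closest_point S (Z t) - closest_point S (X t))"
          using lipschitz_on_normD[OF L cp cp, of "Z t" "X t"] by (simp add: Xt)
        also have "\<dots> \<le> L * norm (Z t - X t)"
          using closest_point_lipschitz[OF S(1-3)] \<open>0 \<le> L\<close> by (intro mult_left_mono) (auto simp: dist_norm)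
        finally have "norm (drift s1 s2 0 (closest_point S (Z t)) - drift s1 s2 0 (X t))
          \<le> L * norm (Z t - X t)" .
        moreover have "norm (f (Z t) - drift s1 s2 0 (closest_point S (Z t))) \<le> e"
          unfolding f_def using eps cp by (intro less_imp_le close) auto
        ultimately show "norm (f (Z t) - drift s1 s2 0 (X t)) \<le> L * norm (Z t - X t) + e"
          using norm_diff_triangle_le by fastforce
      qed (use Z Xc X' T e \<open>0 \<le> L\<close> in \<open>auto intro: continuous_on_subset\<close>)
      also have "e\<^sup>2 * T * exp ((2 * L + 1) * T) \<le> e\<^sup>2 * (T1 * exp ((2 * L + 1) * T1))"
        unfolding mult.assoc using T \<open>0 \<le> L\<close> by (intro mult_left_mono mult_mono) auto
      also have "\<dots> < \<eta>\<^sup>2" using e by (simp add: C_def)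
      finally show ?thesis
        unfolding dist_norm by (rule power2_less_imp_less) (use \<open>0 < \<eta>\<close> in simp)
    qed
    have ZS: "Z T \<in> S" if "0 \<le> T" "T \<le> T1" for T
    proof -
      have "norm (Z T) \<le> norm (X T) + dist (Z T) (X T)"
        unfolding dist_norm by (metis add.commute diff_add_cancel norm_triangle_ineq)
      then show ?thesis using near[OF that] dist[OF that] by (simp add: S_def)
    qed
    have "constrained_solution s1 s2 eps xi0 (ereal T1) Z (\<lambda>T. Z T - eps) (\<lambda>T. multiplier s1 s2 eps (Z T))"
    proof (rule constrained_solutionI)
      show "(Z has_vector_derivative drift s1 s2 eps (Z T)) (at T)" if "0 < T" "ereal T < ereal T1" for T
        using Z(3)[of T] ZS[of T] that by (simp add: f_def closest_point_self)
      show "Z T \<in> ball 0 1 \<and> Z T - eps \<in> ball 0 1" if "0 \<le> T" "ereal T < ereal T1" for T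
        using disk[of eps, OF _ ZS[of T]] that eps by simp
    qed (use Z eps \<open>0 < T1\<close> in auto)
    with dist show ?thesis by auto
  qed
  moreover have "\<forall>\<^sub>F eps in at (0::real^2). eps \<noteq> 0 \<and> norm eps < \<delta> \<and> norm eps < d"
    unfolding eventually_at using \<delta> d by (intro exI[of _ "min \<delta> d"]) auto
  ultimately show ?thesis by (auto elim: eventually_mono)
qed

lemma maximal_constrained_converge:
  assumes xi0: "norm xi0 < 1" and "0 < T0"
    and sol: "\<forall>\<^sub>F eps in at 0. maximal_constrained_solution s1 s2 eps xi0 (\<tau> eps) (X1 eps) (X2 eps) (lam eps)"
    and X: "limit_solution s1 s2 xi0 X mu"
  shows "\<forall>\<^sub>F eps in at 0. ereal T0 < \<tau> eps"
    and "uniform_limit {0..T0} X1 X (at 0)"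
    and "uniform_limit {0..T0} X2 X (at 0)"
    and "uniform_limit {0<..T0} lam mu (at 0)"
proof -
  \<comment> \<open>A solution living up to a time beyond \<open>T0\<close> makes the maximal one outlive \<open>T0\<close>.\<close>
  define T1 where "T1 = T0 + 1"
  obtain Y where Y: "limit_solution s1 s2 xi0 Y (\<lambda>T. multiplier s1 s2 0 (Y T))" "\<And>T. norm (Y T) < 1"
    using limit_solution_explicit[OF xi0] by metis
  have nX: "norm (X T) < 1" if "0 \<le> T" for T
    using limit_solution_unique(1)[OF X Y(1) that] Y(2) by simp
  have Xc: "continuous_on {0..T1} X"
    using X by (auto simp: limit_solution_def intro: continuous_on_subset)
  have "\<exists>t\<in>{0..T1}. \<forall>T\<in>{0..T1}. norm (X T) \<le> norm (X t)"
    using \<open>0 < T0\<close> by (intro continuous_attains_sup continuous_intros Xc) (auto simp: T1_def)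
  then obtain t where t: "0 \<le> t" "\<And>T. 0 \<le> T \<Longrightarrow> T \<le> T1 \<Longrightarrow> norm (X T) \<le> norm (X t)" by auto
  \<comment> \<open>Half the distance to the circle from the point of the limit trajectory on
    \<open>[0, T1]\<close> that is farthest from the origin.\<close>
  define \<eta>0 where "\<eta>0 = (1 - norm (X t)) / 2"
  define r where "r = norm (X t) + \<eta>0"
  have \<eta>0: "0 < \<eta>0" "r < 1" using nX[OF t(1)] by (auto simp: \<eta>0_def r_def field_simps)
  \<comment> \<open>The closeness \<open>\<eta>\<close> varies while \<open>r\<close> stays fixed,
    so that the multiplier can be studied on a single compact set.\<close>
  have key: "\<forall>\<^sub>F eps in at 0. ereal T0 < \<tau> eps \<and>
      (\<forall>T\<in>{0..T0}. dist (X1 eps T) (X T) < \<eta> \<and> X1 eps T \<in> cball 0 r \<and> X2 eps T = X1 eps T - eps) \<and>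
      (\<forall>T\<in>{0<..T0}. lam eps T = multiplier s1 s2 eps (X1 eps T))"
    if \<eta>: "0 < \<eta>" "\<eta> \<le> \<eta>0" for \<eta>
  proof -
    have near: "norm (X T) + \<eta> \<le> r" if "0 \<le> T" "T \<le> T1" for T
      using t(2)[OF that] \<eta> by (simp add: r_def)
    have "\<forall>\<^sub>F eps in at 0. \<exists>Z mu. constrained_solution s1 s2 eps xi0 (ereal T1) Z (\<lambda>T. Z T - eps) mu
        \<and> (\<forall>T\<in>{0..T1}. dist (Z T) (X T) < \<eta>)"
      using \<open>0 < T0\<close> by (intro constrained_near_limit[OF xi0 _ \<eta>(1) \<eta>0(2) X near]) (auto simp: T1_def)
    moreover have "\<forall>\<^sub>F eps in at (0::real^2). eps \<noteq> 0" by (simp add: eventually_at_filter)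
    ultimately show ?thesis using sol
    proof eventually_elim
      case (elim eps)
      then obtain Z m where Z: "constrained_solution s1 s2 eps xi0 (ereal T1) Z (\<lambda>T. Z T - eps) m"
        and dZ: "\<forall>T\<in>{0..T1}. dist (Z T) (X T) < \<eta>" by blast
      have X1: "constrained_solution s1 s2 eps xi0 (\<tau> eps) (X1 eps) (X2 eps) (lam eps)"
        and "ereal T1 \<le> \<tau> eps"
        using elim Z by (auto simp: maximal_constrained_solution_def)
      have "ereal T0 < ereal T1" by (simp add: T1_def)
      also note \<open>ereal T1 \<le> \<tau> eps\<close>
      finally have \<tau>: "ereal T0 < \<tau> eps" .
      have tau: "ereal T < \<tau> eps" if "T \<le> T0" for T
        using ereal_le_less_trans[OF that \<tau>] .
      have eq: "X1 eps T = Z T" if "0 \<le> T" "T \<le> T0" for T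
        using constrained_unique(1)[OF elim(2) X1 Z that(1)] tau[OF that(2)] that by (simp add: T1_def)
      have "dist (X1 eps T) (X T) < \<eta> \<and> X1 eps T \<in> cball 0 r \<and> X2 eps T = X1 eps T - eps"
        if "0 \<le> T" "T \<le> T0" for T
      proof (intro conjI)
        show d: "dist (X1 eps T) (X T) < \<eta>" using eq[OF that] dZ that by (simp add: T1_def)
        have "norm (X1 eps T) \<le> norm (X T) + dist (X1 eps T) (X T)"
          unfolding dist_norm by (metis add.commute diff_add_cancel norm_triangle_ineq)
        then show "X1 eps T \<in> cball 0 r" using near[of T] d that by (simp add: T1_def)
        show "X2 eps T = X1 eps T - eps"
          using constrained_solutionD(1)[OF X1 that(1) tau[OF that(2)]] .
      qed
      moreover have "lam eps T = multiplier s1 s2 eps (X1 eps T)" if "0 < T" "T \<le> T0" for T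
        using constrained_solutionD(7)[OF X1 _ tau[OF that(2)] elim(2)] that by simp
      ultimately show ?case using \<tau> by auto
    qed
  qed
  note key0 = key[OF \<eta>0(1) order_refl]
  show "\<forall>\<^sub>F eps in at 0. ereal T0 < \<tau> eps" using key0 by (rule eventually_mono) simp
  show lim1: "uniform_limit {0..T0} X1 X (at 0)"
  proof (rule uniform_limitI)
    fix e :: real assume "0 < e"
    then show "\<forall>\<^sub>F eps in at 0. \<forall>T\<in>{0..T0}. dist (X1 eps T) (X T) < e"
      using key[of "min e \<eta>0"] \<eta>0(1) by (auto elim: eventually_mono)
  qed
  have id: "uniform_limit A (\<lambda>(eps::real^2) T. eps) (\<lambda>T. 0) (at 0)" for A :: "real set"
    by (rule uniform_limitI) (use tendstoD[OF tendsto_ident_at, of _ "0::real^2"] in \<open>auto elim: eventually_mono\<close>)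
  have "uniform_limit {0..T0} (\<lambda>eps T. X1 eps T - eps) (\<lambda>T. X T - 0) (at 0)"
    by (intro uniform_limit_minus lim1 id)
  moreover have "\<forall>\<^sub>F eps in at 0. \<forall>T\<in>{0..T0}. X2 eps T = X1 eps T - eps"
    using key0 by (rule eventually_mono) simp
  ultimately show "uniform_limit {0..T0} X2 X (at 0)"
    by (subst uniform_limit_cong) auto
  define \<delta> where "\<delta> = (1 - r) / 2"
  define B where "B = cball (0::real^2) \<delta> \<times> cball (0::real^2) r"
  have \<delta>: "0 < \<delta>" using \<eta>0 by (simp add: \<delta>_def)
  have Bgap: "0 < pair_gap x (x - eps)" if "(eps, x) \<in> B" for eps x
  proof (rule pair_gap_pos_open)
    show "norm x < 1" using that \<eta>0 by (simp add: B_def)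
    have "norm (x - eps) \<le> norm x + norm eps" by (rule norm_triangle_ineq4)
    then show "norm (x - eps) < 1" using that \<eta>0 by (simp add: B_def \<delta>_def field_simps)
  qed
  \<comment> \<open>Uniform continuity on this compact set transports the uniform convergence of
    \<open>(eps, X1 eps T)\<close> to the multipliers.\<close>
  have uc: "uniformly_continuous_on B (\<lambda>(eps, x). multiplier s1 s2 eps x)"
    by (intro compact_uniformly_continuous continuous_drift_multiplier Bgap)
      (auto simp: B_def intro!: compact_Times)
  have "uniform_limit {0<..T0} (\<lambda>eps T. (\<lambda>(eps, x). multiplier s1 s2 eps x) (eps, X1 eps T))
      (\<lambda>T. (\<lambda>(eps, x). multiplier s1 s2 eps x) (0, X T)) (at 0)"
  proof (rule uniform_limit_compose_uniformly_continuous_on[OF _ uc])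
    show "uniform_limit {0<..T0} (\<lambda>eps T. (eps, X1 eps T)) (\<lambda>T. (0, X T)) (at 0)"
    proof (rule uniform_limitI)
      fix e :: real assume e: "0 < e"
      have "\<forall>\<^sub>F eps in at 0. \<forall>T\<in>{0..T0}. dist (X1 eps T) (X T) < e / 2"
        using uniform_limitD[OF lim1, of "e / 2"] e by simp
      moreover have "\<forall>\<^sub>F eps in at (0::real^2). dist eps 0 < e / 2"
        using tendstoD[OF tendsto_ident_at, of "e / 2" "0::real^2"] e by simp
      ultimately show "\<forall>\<^sub>F eps in at 0. \<forall>T\<in>{0<..T0}. dist (eps, X1 eps T) (0, X T) < e"
      proof eventually_elim
        case (elim eps)
        show ?case
        proof
          fix T assume "T \<in> {0<..T0}"
          then have "dist (X1 eps T) (X T) < e / 2" using elim(1) by simp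
          moreover have "dist (eps, X1 eps T) (0, X T) \<le> dist eps 0 + dist (X1 eps T) (X T)"
            unfolding dist_Pair_Pair by (rule sqrt_sum_squares_le_sum) auto
          ultimately show "dist (eps, X1 eps T) (0, X T) < e" using elim(2) by linarith
        qed
      qed
    qed
    have "\<forall>\<^sub>F eps in at (0::real^2). dist eps 0 < \<delta>"
      using tendstoD[OF tendsto_ident_at, of \<delta> "0::real^2"] \<delta> by simp
    with key0 show "\<forall>\<^sub>F eps in at 0. \<forall>T\<in>{0<..T0}. (eps, X1 eps T) \<in> B"
      by eventually_elim (auto simp: B_def dist_commute)
    show "closed B" by (auto simp: B_def intro: closed_Times)
  qed
  moreover have "\<forall>\<^sub>F eps in at 0. \<forall>T\<in>{0<..T0}. lam eps T = multiplier s1 s2 eps (X1 eps T)"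
    using key0 by (rule eventually_mono) simp
  ultimately show "uniform_limit {0<..T0} lam mu (at 0)"
    using X by (subst uniform_limit_cong) (auto simp: limit_solution_iff)
qed

text \<open>Convergence is uniform on bounded time intervals, for the multiplier without time 0,
  where it is unspecified. Since a solution may leave the disk in finite time, the eventual lower
  bound on the lifetimes belongs to the claim. The family of maximal solutions is required for
  \<open>eps\<close> near 0, because for large \<open>eps\<close> the point \<open>xi0 - eps\<close>
  is outside the disk.\<close>

theorem mainTheorem4:
  fixes s1 s2 :: real and xi0 :: "real^2"
  assumes "s1 \<noteq> 0" and "s2 \<noteq> 0" and "xi0 \<in> ball 0 1 - {0}"
  shows
    "(\<forall>eps \<tau> X1 X2 lam. eps \<noteq> 0 \<longrightarrow>
        (constrained_solution s1 s2 eps xi0 \<tau> X1 X2 lam \<longleftrightarrow>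
         decoupled_solution s1 s2 eps xi0 \<tau> X1 X2 lam)) \<and>
     (\<forall>eps. eps \<noteq> 0 \<and> xi0 - eps \<in> ball 0 1 \<longrightarrow>
        (\<exists>\<tau> X1 X2 lam. maximal_constrained_solution s1 s2 eps xi0 \<tau> X1 X2 lam)) \<and>
     (\<forall>eps \<tau> X1 X2 lam \<tau>' Y1 Y2 mu. eps \<noteq> 0 \<and>
        constrained_solution s1 s2 eps xi0 \<tau> X1 X2 lam \<and>
        constrained_solution s1 s2 eps xi0 \<tau>' Y1 Y2 mu \<longrightarrow>
          (\<forall>T. 0 \<le> T \<and> ereal T < min \<tau> \<tau>' \<longrightarrow>
             X1 T = Y1 T \<and> X2 T = Y2 T \<and> (0 < T \<longrightarrow> lam T = mu T))) \<and>
     (\<exists>Xe lame. limit_solution s1 s2 xi0 Xe lame) \<and>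
     (\<forall>Xe lame Ye mue.
        limit_solution s1 s2 xi0 Xe lame \<and> limit_solution s1 s2 xi0 Ye mue \<longrightarrow>
          (\<forall>T\<ge>0. Xe T = Ye T \<and> (0 < T \<longrightarrow> lame T = mue T))) \<and>
     (\<forall>(\<tau> :: real^2 \<Rightarrow> ereal) (X1 :: real^2 \<Rightarrow> real \<Rightarrow> real^2) X2 lam Xe lame.
        (\<forall>\<^sub>F eps in at 0.
           maximal_constrained_solution s1 s2 eps xi0 (\<tau> eps) (X1 eps) (X2 eps) (lam eps)) \<and>
        limit_solution s1 s2 xi0 Xe lame \<longrightarrow>
          (\<forall>T0>0.
             (\<forall>\<^sub>F eps in at 0. ereal T0 < \<tau> eps) \<and>
             uniform_limit {0..T0} X1 Xe (at 0) \<and>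
             uniform_limit {0..T0} X2 Xe (at 0) \<and>
             uniform_limit {0<..T0} lam lame (at 0)))"
proof -
  have xi0: "xi0 \<in> ball 0 1" "norm xi0 < 1" using assms(3) by auto
  show ?thesis
  proof (intro conjI; (intro allI impI)?; (elim conjE)?)
    show "X1 T = Y1 T \<and> X2 T = Y2 T \<and> (0 < T \<longrightarrow> lam T = mu T)"
      if "eps \<noteq> 0" "constrained_solution s1 s2 eps xi0 \<tau> X1 X2 lam"
        "constrained_solution s1 s2 eps xi0 \<tau>' Y1 Y2 mu" "0 \<le> T" "ereal T < min \<tau> \<tau>'"
      for eps \<tau> X1 X2 lam \<tau>' Y1 Y2 mu T
      using constrained_unique[OF that(1-4)] that(5) by simp
    show "\<exists>Xe lame. limit_solution s1 s2 xi0 Xe lame"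
      using limit_solution_explicit[OF xi0(2)] by metis
    show "Xe T = Ye T \<and> (0 < T \<longrightarrow> lame T = mue T)"
      if "0 \<le> T" "limit_solution s1 s2 xi0 Xe lame" "limit_solution s1 s2 xi0 Ye mue"
      for Xe lame Ye mue T
      using limit_solution_unique[OF that(2,3,1)] by simp
    show "(\<forall>\<^sub>F eps in at 0. ereal T0 < \<tau> eps) \<and> uniform_limit {0..T0} X1 Xe (at 0) \<and>
        uniform_limit {0..T0} X2 Xe (at 0) \<and> uniform_limit {0<..T0} lam lame (at 0)"
      if "0 < T0" "\<forall>\<^sub>F eps in at 0.
           maximal_constrained_solution s1 s2 eps xi0 (\<tau> eps) (X1 eps) (X2 eps) (lam eps)"
        "limit_solution s1 s2 xi0 Xe lame" for \<tau> X1 X2 lam Xe lame T0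
      using maximal_constrained_converge[OF xi0(2) that] by blast
    show "constrained_solution s1 s2 eps xi0 \<tau> X1 X2 lam \<longleftrightarrow> decoupled_solution s1 s2 eps xi0 \<tau> X1 X2 lam"
      for eps \<tau> X1 X2 lam
      by (rule constrained_iff_decoupled)
    show "\<exists>\<tau> X1 X2 lam. maximal_constrained_solution s1 s2 eps xi0 \<tau> X1 X2 lam"
      if "eps \<noteq> 0" "xi0 - eps \<in> ball 0 1" for eps
      using that(1) xi0(1) that(2) by (rule maximal_constrained_solution_exists)
  qed
qed

end
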